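(* Let $\theta\in(0,1]$, let $\{\mathcal T_j,\mathbb V_j\}_{j\ge 0}$ be the sequence of meshes and finite element spaces produced by the goal-oriented adaptive algorithm GOAFEM with marking parameter $\theta$, and let the initial mesh size $h_0$ be sufficiently small, so that the combined quasi-error $$\bar Q_j^2(u_j,\hat z_j)=|||\hat z-\hat z_j|||^2+\gamma\,\zeta_j^2(\hat z_j)+\pi\,|||u-u_j|||^2+\pi\gamma_p\,\eta_j^2(u_j)$$ satisfies the contraction $\bar Q_{j+1}^2(u_{j+1},\hat z_{j+1})\le\alpha_D^2\,\bar Q_j^2(u_j,\hat z_j)$ for all $j\ge0$ with constants $\gamma,\gamma_p,\pi>0$ and $\alpha_D\in(0,1)$. Then the error in the goal function is controlled by a constant multiple of the square of the combined quasi-error: there is a constant $C>0$, independent of $j$, such that for all $j\ge 0$ $$|g(u)-g(u_j)|\le C\,\bar Q_j^2(u_j,\hat z_j)\le\alpha_D^{2j}\,C\,\bar Q_0^2(u_0,\hat z_0).$$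
   Context: **Problem data.** $\Omega\subset\mathbb R^d$ ($d=2$ or $3$) is a polyhedral domain and $\langle\cdot,\cdot\rangle$ is the $L_2(\Omega)$ pairing. The data $\mathbf D=(A,b,f)$ satisfy: $A:\Omega\to\mathbb R^{d\times d}$ is Lipschitz and symmetric positive definite with $\inf_x\lambda_{\min}(A(x))=\mu_0>0$ and $\sup_x\lambda_{\max}(A(x))=\mu_1<\infty$; $b:\Omega\times\mathbb R\to\mathbb R$ is smooth in its second argument (one writes $b(u)$ for $b(x,u(x))$, and $b'$ is the derivative in the second argument) and $b'\ge 0$; $f\in L_2(\Omega)$. Also $g\in L_2(\Omega)$, $f(v)=\int_\Omega fv$, $g(v)=\int_\Omega gv$. Set $a(u,v)=\int_\Omega A\nabla u\cdot\nabla v\,dx$ and $|||v|||^2=a(v,v)$. **Meshes and spaces.** $\mathcal T_0$ is an initial conforming, shape-regular triangulation of $\Omega$ into closed simplices; all further meshes are conforming refinements obtained by newest vertex bisection. $h_T=|T|^{1/d}$ and $h_0=\max_{T\in\mathcal T_0}h_T$. $\mathbb V_{\mathcal T}=\{v\in H_0^1(\Omega): v|_T\in\mathbb P_n(T)\ \forall T\in\mathcal T\}$ for a fixed degree $n$, and $\mathbb V_k=\mathbb V_{\mathcal T_k}$. **Problems.** - Primal: $u\in H_0^1(\Omega)$, $a(u,v)+\langle b(u),v\rangle=f(v)$ for all $v\in H_0^1(\Omega)$. - Discrete primal: $u_k\in\mathbb V_k$ satisfies the same equation for all $v\in\mathbb V_k$. - Limiting dual: $\hat z\in H_0^1(\Omega)$,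 $a(\hat z,v)+\langle b'(u)\hat z,v\rangle=g(v)$ for all $v\in H^1_0(\Omega)$. - Discrete limiting dual: $\hat z_k\in\mathbb V_k$ satisfies the latter equation for all $v\in\mathbb V_k$. - Approximate dual: $\hat z_k^k\in\mathbb V_k$, $a(\hat z_k^k,v)+\langle b'(u_k)\hat z_k^k,v\rangle=g(v)$ for all $v\in\mathbb V_k$. **A priori bounds.** There are $u_\pm\in L_\infty(\Omega)$ with $u_-\le u,u_k\le u_+$ a.e. for all $k$. For a.e. $x$, $b(x,\cdot)$ and $b'(x,\cdot)$ are Lipschitz on $[u_-(x),u_+(x)]$ with constants $B$ and $\Theta$. There are $z_\pm\in L_\infty(\Omega)$ with $z_-\le\hat z,\hat z_k,\hat z_k^k\le z_+$ a.e. for all $k$. **Regularity.** For some $0<s\le 1$ and constants $K_R,\bar K_R$ independent of $j$: the solution $w\in H_0^1(\Omega)$ of $a(w,v)+\langle\mathcal B_jw,v\rangle=\langle u-u_j,v\rangle$ for all $v\in H^1_0(\Omega)$, with $\mathcal B_j=\int_0^1b'(\xi u+(1-\xi)u_j)\,d\xi$, lies in $H^{1+s}(\Omega)$ with $|w|_{H^{1+s}}\le K_R\|u-u_j\|_{L_2}$; and the solution $y\in H^1_0(\Omega)$ of $a(y,v)+\langle b'(u)y,v\rangle=(\hat z-\hat z_j,v)$ for all $v\in H^1_0(\Omega)$ lies in $H^{1+s}(\Omega)$ with $|y|_{H^{1+s}}\le\bar K_R\|\hat z-\hat z_j\|_{L_2}$. **Estimators.** $J_T(v)=[\![ A\nabla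 v\cdot n]\!]_{\partial T}$ is the jump across $\partial T$ of the normal flux (only interior faces contribute). For $v\in\mathbb V_k$, $T\in\mathcal T_k$: $$\eta_k^2(v,T)=h_T^2\|f+\nabla\cdot(A\nabla v)-b(v)\|_{L_2(T)}^2+h_T\|J_T(v)\|^2_{L_2(\partial T)},$$ $$\zeta_{k,j}^2(v,T)=h_T^2\|g+\nabla\cdot(A\nabla v)-b'(u_j)v\|_{L_2(T)}^2+h_T\|J_T(v)\|^2_{L_2(\partial T)},$$ $$\zeta_{k}^2(v,T)=h_T^2\|g+\nabla\cdot(A\nabla v)-b'(u)v\|_{L_2(T)}^2+h_T\|J_T(v)\|^2_{L_2(\partial T)}.$$ For $\mathcal S\subseteq\mathcal T_k$, $\eta_k^2(v,\mathcal S)=\sum_{T\in\mathcal S}\eta_k^2(v,T)$, similarly for $\zeta_{k,j},\zeta_k$; the set is omitted when $\mathcal S=\mathcal T_k$. **GOAFEM.** At step $k$: solve exactly for $u_k$ and $\hat z_k^k$; choose $\mathcal M_p,\mathcal M_d\subset\mathcal T_k$ with $\eta_k^2(u_k,\mathcal M_p)\ge\theta^2\eta_k^2(u_k)$ and $\zeta_{k,k}^2(\hat z^k_k,\mathcal M_d)\ge\theta^2\zeta_{k,k}^2(\hat z_k^k)$; set $\mathcal M=\mathcal M_p\cup\mathcal M_d$; let $\mathcal T_{k+1}$ be the conforming refinement obtained by bisecting (newest vertex bisection, with completion) all elements of $\mathcal M$. **Constant $\gamma_p$.** $\gamma_p>0$ is a constant for which, with some $\alpha\in(0,1)$, $|||u-u_{j+1}|||^2+\gamma_p\eta_{j+1}^2(u_{j+1})\le\alpha^2(|||u-u_j|||^2+\gamma_p\eta_j^2(u_j))$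 for all $j\ge0$. The constants $\gamma,\pi,\alpha_D$ are those for which the contraction of the combined quasi-error holds. *)

theory Defs
  imports "HOL-Analysis.Analysis"
begin

section \<open>Test functions and Sobolev spaces\<close>

text \<open>Functions are total on \<open>real^'d\<close>; only their values on the set under consideration, up to
  null sets for members of \<open>L\<^sup>2\<close> and Sobolev spaces, are relevant.\<close>

definition partial_deriv :: "'d \<Rightarrow> (real^'d \<Rightarrow> real) \<Rightarrow> real^'d \<Rightarrow> real" where
  "partial_deriv i f x = frechet_derivative f (at x) (axis i 1)"

primrec C_k :: "nat \<Rightarrow> (real^'d \<Rightarrow> real) \<Rightarrow> bool" where
  "C_k 0 f \<longleftrightarrow> continuous_on UNIV f"
| "C_k (Suc k) f \<longleftrightarrow> (\<forall>x. f differentiable (at x)) \<and> (\<forall>i. C_k k (partial_deriv i f))"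

definition test_functions :: "(real^'d) set \<Rightarrow> (real^'d \<Rightarrow> real) set" where
  "test_functions \<Omega> = {\<phi>. (\<forall>k. C_k k \<phi>) \<and> compact (closure {x. \<phi> x \<noteq> 0}) \<and> closure {x. \<phi> x \<noteq> 0} \<subseteq> \<Omega>}"

definition L2 :: "(real^'d) set \<Rightarrow> (real^'d \<Rightarrow> 'b::euclidean_space) set" where
  "L2 S = {v. v \<in> borel_measurable (lebesgue_on S) \<and> integrable (lebesgue_on S) (\<lambda>x. (norm (v x))\<^sup>2)}"

definition L2norm :: "(real^'d) set \<Rightarrow> (real^'d \<Rightarrow> 'b::euclidean_space) \<Rightarrow> real" where
  "L2norm S v = sqrt (LINT x|lebesgue_on S. (norm (v x))\<^sup>2)"

definition Linf :: "(real^'d) set \<Rightarrow> (real^'d \<Rightarrow> real) set" where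
  "Linf S = {v. v \<in> borel_measurable (lebesgue_on S) \<and> (\<exists>M. AE x in lebesgue_on S. \<bar>v x\<bar> \<le> M)}"

definition pairing :: "(real^'d) set \<Rightarrow> (real^'d \<Rightarrow> real) \<Rightarrow> (real^'d \<Rightarrow> real) \<Rightarrow> real" where
  "pairing \<Omega> f v = (LINT x|lebesgue_on \<Omega>. f x * v x)"

definition weak_gradient :: "(real^'d) set \<Rightarrow> (real^'d \<Rightarrow> real) \<Rightarrow> (real^'d \<Rightarrow> real^'d) \<Rightarrow> bool" where
  "weak_gradient \<Omega> v G \<longleftrightarrow> v \<in> L2 \<Omega> \<and> G \<in> L2 \<Omega> \<and>
     (\<forall>\<phi>\<in>test_functions \<Omega>. \<forall>i.
        (LINT x|lebesgue_on \<Omega>. v x * partial_deriv i \<phi> x) = - (LINT x|lebesgue_on \<Omega>. G x $ i * \<phi> x))"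

definition H1 :: "(real^'d) set \<Rightarrow> (real^'d \<Rightarrow> real) set" where
  "H1 \<Omega> = {v. \<exists>G. weak_gradient \<Omega> v G}"

text \<open>The weak gradient is determined up to null sets.\<close>

definition wgrad :: "(real^'d) set \<Rightarrow> (real^'d \<Rightarrow> real) \<Rightarrow> real^'d \<Rightarrow> real^'d" where
  "wgrad \<Omega> v = (SOME G. weak_gradient \<Omega> v G)"

definition H1norm :: "(real^'d) set \<Rightarrow> (real^'d \<Rightarrow> real) \<Rightarrow> real" where
  "H1norm \<Omega> v = sqrt ((L2norm \<Omega> v)\<^sup>2 + (L2norm \<Omega> (wgrad \<Omega> v))\<^sup>2)"

definition H10 :: "(real^'d) set \<Rightarrow> (real^'d \<Rightarrow> real) set" where
  "H10 \<Omega> = {v \<in> H1 \<Omega>. \<exists>\<phi>. (\<forall>m::nat. \<phi> m \<in> test_functions \<Omega>) \<and>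
                           (\<lambda>m. H1norm \<Omega> (\<lambda>x. v x - \<phi> m x)) \<longlonglongrightarrow> 0}"

text \<open>\<open>H\<^bsup>1+s\<^esup>(\<Omega>)\<close> for \<open>0 < s \<le> 1\<close>, with the Sobolev--Slobodeckij seminorm if \<open>s < 1\<close>.\<close>

definition slobodeckij_integrand :: "real \<Rightarrow> (real^'d \<Rightarrow> real^'d) \<Rightarrow> (real^'d) \<times> (real^'d) \<Rightarrow> real" where
  "slobodeckij_integrand s G = (\<lambda>(x, y). (norm (G x - G y))\<^sup>2 / norm (x - y) powr (real CARD('d) + 2 * s))"

definition H1s :: "(real^'d) set \<Rightarrow> real \<Rightarrow> (real^'d \<Rightarrow> real) set" where
  "H1s \<Omega> s = {w \<in> H1 \<Omega>.
     if s = 1 then \<forall>i. (\<lambda>x. wgrad \<Omega> w x $ i) \<in> H1 \<Omega>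
     else integrable (lebesgue_on \<Omega> \<Otimes>\<^sub>M lebesgue_on \<Omega>) (slobodeckij_integrand s (wgrad \<Omega> w))}"

definition H1s_seminorm :: "(real^'d) set \<Rightarrow> real \<Rightarrow> (real^'d \<Rightarrow> real) \<Rightarrow> real" where
  "H1s_seminorm \<Omega> s w =
     (if s = 1 then sqrt (\<Sum>i\<in>UNIV. (L2norm \<Omega> (wgrad \<Omega> (\<lambda>x. wgrad \<Omega> w x $ i)))\<^sup>2)
      else sqrt (integral\<^sup>L (lebesgue_on \<Omega> \<Otimes>\<^sub>M lebesgue_on \<Omega>) (slobodeckij_integrand s (wgrad \<Omega> w))))"


section \<open>Domain, coefficients and weak problems\<close>

definition polyhedral_domain :: "(real^'d) set \<Rightarrow> bool" where
  "polyhedral_domain \<Omega> \<longleftrightarrow> \<Omega> \<noteq> {} \<and> connected \<Omega> \<and>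
     (\<exists>P. finite P \<and> (\<forall>p\<in>P. polytope p) \<and> \<Omega> = interior (\<Union>P))"

definition eigenvals :: "real^'d^'d \<Rightarrow> real set" where
  "eigenvals M = {l. \<exists>v. v \<noteq> 0 \<and> M *v v = l *\<^sub>R v}"

definition lambda_min :: "real^'d^'d \<Rightarrow> real" where "lambda_min M = Min (eigenvals M)"
definition lambda_max :: "real^'d^'d \<Rightarrow> real" where "lambda_max M = Max (eigenvals M)"

definition elliptic_coefficient :: "(real^'d) set \<Rightarrow> (real^'d \<Rightarrow> real^'d^'d) \<Rightarrow> real \<Rightarrow> real \<Rightarrow> bool" where
  "elliptic_coefficient \<Omega> A \<mu>0 \<mu>1 \<longleftrightarrow>
     (\<exists>L. L-lipschitz_on \<Omega> A) \<and>
     (\<forall>x\<in>\<Omega>. transpose (A x) = A x \<and> (\<forall>v. v \<noteq> 0 \<longrightarrow> 0 < (A x *v v) \<bullet> v)) \<and>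
     (INF x\<in>\<Omega>. lambda_min (A x)) = \<mu>0 \<and> 0 < \<mu>0 \<and>
     bdd_above ((\<lambda>x. lambda_max (A x)) ` \<Omega>) \<and> (SUP x\<in>\<Omega>. lambda_max (A x)) = \<mu>1"

definition smooth_monotone :: "(real^'d) set \<Rightarrow> (real^'d \<Rightarrow> real \<Rightarrow> real) \<Rightarrow> bool" where
  "smooth_monotone \<Omega> b \<longleftrightarrow>
     (\<forall>x\<in>\<Omega>. (\<forall>m t. (deriv ^^ m) (b x) field_differentiable (at t)) \<and> (\<forall>t. 0 \<le> deriv (b x) t))"

definition afrm :: "(real^'d) set \<Rightarrow> (real^'d \<Rightarrow> real^'d^'d) \<Rightarrow> (real^'d \<Rightarrow> real) \<Rightarrow> (real^'d \<Rightarrow> real) \<Rightarrow> real" where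
  "afrm \<Omega> A v w = (LINT x|lebesgue_on \<Omega>. (A x *v wgrad \<Omega> v x) \<bullet> wgrad \<Omega> w x)"

definition energy_norm :: "(real^'d) set \<Rightarrow> (real^'d \<Rightarrow> real^'d^'d) \<Rightarrow> (real^'d \<Rightarrow> real) \<Rightarrow> real" where
  "energy_norm \<Omega> A v = sqrt (afrm \<Omega> A v v)"

text \<open>In both problems the reaction term is required to lie in \<open>L\<^sup>2(\<Omega>)\<close>, so that the
  pairing with it is a genuine \<open>L\<^sup>2\<close> pairing rather than the default value of a non-existing integral.\<close>

definition semilinear_solution ::
  "(real^'d) set \<Rightarrow> (real^'d \<Rightarrow> real^'d^'d) \<Rightarrow> (real^'d \<Rightarrow> real \<Rightarrow> real) \<Rightarrow> (real^'d \<Rightarrow> real) \<Rightarrow>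
   (real^'d \<Rightarrow> real) set \<Rightarrow> (real^'d \<Rightarrow> real) \<Rightarrow> bool" where
  "semilinear_solution \<Omega> A b f V u \<longleftrightarrow> u \<in> V \<and> (\<lambda>x. b x (u x)) \<in> L2 \<Omega> \<and>
     (\<forall>v\<in>V. afrm \<Omega> A u v + pairing \<Omega> (\<lambda>x. b x (u x)) v = pairing \<Omega> f v)"

definition linear_solution ::
  "(real^'d) set \<Rightarrow> (real^'d \<Rightarrow> real^'d^'d) \<Rightarrow> (real^'d \<Rightarrow> real) \<Rightarrow> (real^'d \<Rightarrow> real) \<Rightarrow>
   (real^'d \<Rightarrow> real) set \<Rightarrow> (real^'d \<Rightarrow> real) \<Rightarrow> bool" where
  "linear_solution \<Omega> A c r V z \<longleftrightarrow> z \<in> V \<and> (\<lambda>x. c x * z x) \<in> L2 \<Omega> \<and>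
     (\<forall>v\<in>V. afrm \<Omega> A z v + pairing \<Omega> (\<lambda>x. c x * z x) v = pairing \<Omega> r v)"


section \<open>Meshes and newest vertex bisection\<close>

text \<open>Bisection needs more than the point set of a simplex: a mesh consists of tagged simplices
  \<open>([x\<^sub>0,\<dots>,x\<^sub>d], \<gamma>)\<close> in the sense of Maubach and Stevenson, with refinement edge \<open>x\<^sub>0 x\<^sub>d\<close>
  and type \<open>\<gamma> < d\<close>. For \<open>d = 2\<close> the type is immaterial and \<open>x\<^sub>1\<close> is the newest vertex.\<close>

type_synonym 'd tagged = "(real^'d) list \<times> nat"

definition tagged_simplex :: "('d::finite) tagged \<Rightarrow> bool" where
  "tagged_simplex t \<longleftrightarrow> length (fst t) = CARD('d) + 1 \<and> distinct (fst t) \<and>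
     \<not> affine_dependent (set (fst t)) \<and> snd t < CARD('d)"

definition elem :: "'d tagged \<Rightarrow> (real^'d) set" where
  "elem t = convex hull (set (fst t))"

text \<open>With \<open>m = (x\<^sub>0 + x\<^sub>d)/2\<close> the children are
  \<open>([x\<^sub>0, m, x\<^sub>1, \<dots>, x\<^sub>d\<^sub>-\<^sub>1], \<gamma>+1 mod d)\<close> and
  \<open>([x\<^sub>d, m, x\<^sub>1, \<dots>, x\<^sub>\<gamma>, x\<^sub>d\<^sub>-\<^sub>1, \<dots>, x\<^sub>\<gamma>\<^sub>+\<^sub>1], \<gamma>+1 mod d)\<close>.\<close>

definition children :: "('d::finite) tagged \<Rightarrow> 'd tagged set" where
  "children t = (let x0 = hd (fst t); xd = last (fst t); ys = butlast (tl (fst t)); k = snd t;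
                     m = midpoint x0 xd; k' = (k + 1) mod CARD('d)
                 in {(x0 # m # ys, k'), (xd # m # take k ys @ rev (drop k ys), k')})"

definition bisect_step :: "('d::finite) tagged set \<Rightarrow> 'd tagged set \<Rightarrow> bool" where
  "bisect_step T T' \<longleftrightarrow> (\<exists>t\<in>T. T' = (T - {t}) \<union> children t)"

definition conforming_mesh :: "(real^'d) set \<Rightarrow> 'd tagged set \<Rightarrow> bool" where
  "conforming_mesh \<Omega> T \<longleftrightarrow> (\<forall>t\<in>T. tagged_simplex t) \<and> inj_on elem T \<and>
     triangulation (elem ` T) \<and> \<Union>(elem ` T) = closure \<Omega>"

text \<open>Every simplex contains a ball of radius at least \<open>1/\<sigma>\<close> times its diameter.\<close>

definition shape_regular :: "real \<Rightarrow> ('d::finite) tagged set \<Rightarrow> bool" where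
  "shape_regular \<sigma> T \<longleftrightarrow> 0 < \<sigma> \<and> (\<forall>t\<in>T. \<exists>x. cball x (diameter (elem t) / \<sigma>) \<subseteq> elem t)"

definition bisection_refinement ::
  "(real^'d) set \<Rightarrow> 'd tagged set \<Rightarrow> 'd tagged set \<Rightarrow> 'd tagged set \<Rightarrow> bool" where
  "bisection_refinement \<Omega> T M T' \<longleftrightarrow> bisect_step\<^sup>*\<^sup>* T T' \<and> conforming_mesh \<Omega> T' \<and> T' \<inter> M = {}"

text \<open>Completion adds only the bisections that are needed for conformity: the refined mesh is the
  coarsest conforming refinement by bisection in which all marked elements are bisected.\<close>

definition refine :: "(real^'d) set \<Rightarrow> 'd tagged set \<Rightarrow> 'd tagged set \<Rightarrow> 'd tagged set \<Rightarrow> bool" where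
  "refine \<Omega> T M T' \<longleftrightarrow> bisection_refinement \<Omega> T M T' \<and>
     (\<forall>T''. bisection_refinement \<Omega> T M T'' \<longrightarrow> bisect_step\<^sup>*\<^sup>* T' T'')"

definition polynomials :: "nat \<Rightarrow> (real^'d \<Rightarrow> real) set" where
  "polynomials n = {p. \<exists>c :: ('d \<Rightarrow> nat) \<Rightarrow> real.
     p = (\<lambda>x. \<Sum>\<alpha> | (\<Sum>i\<in>UNIV. \<alpha> i) \<le> n. c \<alpha> * (\<Prod>i\<in>UNIV. (x $ i) ^ \<alpha> i))}"

text \<open>Agreement with a polynomial is required at every point of the closed element, that is, a finite
  element function is taken to be its continuous representative.\<close>

definition fe_space :: "(real^'d) set \<Rightarrow> nat \<Rightarrow> 'd tagged set \<Rightarrow> (real^'d \<Rightarrow> real) set" where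
  "fe_space \<Omega> n T = {v \<in> H10 \<Omega>. \<forall>t\<in>T. \<exists>p\<in>polynomials n. \<forall>x\<in>elem t. v x = p x}"


section \<open>Error estimators\<close>

text \<open>Derivatives within the closed element \<open>K\<close>: for finite element functions this is the gradient of
  the polynomial \<open>v|\<^sub>K\<close>, also at boundary points, where it is the trace taken from inside \<open>K\<close>.\<close>

definition egrad :: "(real^'d) set \<Rightarrow> (real^'d \<Rightarrow> real) \<Rightarrow> real^'d \<Rightarrow> real^'d" where
  "egrad K v x = (\<chi> i. frechet_derivative v (at x within K) (axis i 1))"

definition flux :: "(real^'d \<Rightarrow> real^'d^'d) \<Rightarrow> (real^'d) set \<Rightarrow> (real^'d \<Rightarrow> real) \<Rightarrow> real^'d \<Rightarrow> real^'d" where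
  "flux A K v x = A x *v egrad K v x"

text \<open>The flux is Lipschitz in \<open>K\<close>, so its pointwise divergence exists almost everywhere
  and equals the weak one.\<close>

definition div_flux :: "(real^'d \<Rightarrow> real^'d^'d) \<Rightarrow> (real^'d) set \<Rightarrow> (real^'d \<Rightarrow> real) \<Rightarrow> real^'d \<Rightarrow> real" where
  "div_flux A K v x =
     (\<Sum>i\<in>UNIV. frechet_derivative (\<lambda>y. flux A K v y $ i) (at x within K) (axis i 1))"

definition outer_normal :: "(real^'d) set \<Rightarrow> (real^'d) set \<Rightarrow> real^'d" where
  "outer_normal K F = (THE \<nu>. norm \<nu> = 1 \<and> (\<forall>x\<in>K. \<forall>y\<in>F. \<nu> \<bullet> (x - y) \<le> 0))"

text \<open>Surface integral over a flat facet \<open>F\<close> with unit normal \<open>\<nu>\<close>, by Fubini equal to the volume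
  integral over the prism \<open>F + [0,1] \<nu>\<close> of height one of the integrand extended constantly along \<open>\<nu>\<close>.\<close>

definition facet_integral :: "real^'d \<Rightarrow> (real^'d) set \<Rightarrow> (real^'d \<Rightarrow> real) \<Rightarrow> real" where
  "facet_integral \<nu> F \<phi> =
     (LINT y|lebesgue_on {x + t *\<^sub>R \<nu> | x t. x \<in> F \<and> 0 \<le> t \<and> t \<le> 1}. \<phi> (closest_point (affine hull F) y))"

definition flux_jump :: "(real^'d \<Rightarrow> real^'d^'d) \<Rightarrow> (real^'d \<Rightarrow> real) \<Rightarrow> (real^'d) set \<Rightarrow> (real^'d) set \<Rightarrow> real^'d \<Rightarrow> real" where
  "flux_jump A v K K' x =
     flux A K v x \<bullet> outer_normal K (K \<inter> K') + flux A K' v x \<bullet> outer_normal K' (K \<inter> K')"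

definition jump_sq :: "(real^'d \<Rightarrow> real^'d^'d) \<Rightarrow> 'd tagged set \<Rightarrow> (real^'d \<Rightarrow> real) \<Rightarrow> (real^'d) set \<Rightarrow> real" where
  "jump_sq A T v K =
     (\<Sum>K' | K' \<in> elem ` T \<and> K' \<noteq> K \<and> (K \<inter> K') facet_of K.
        facet_integral (outer_normal K (K \<inter> K')) (K \<inter> K') (\<lambda>x. (flux_jump A v K K' x)\<^sup>2))"

definition mesh_size :: "('d::finite) tagged \<Rightarrow> real" where
  "mesh_size t = measure lebesgue (elem t) powr (1 / real CARD('d))"

text \<open>Residual estimator for right-hand side \<open>r\<close> and reaction term \<open>c\<close>.\<close>

definition estimator_sq ::
  "(real^'d \<Rightarrow> real^'d^'d) \<Rightarrow> (real^'d \<Rightarrow> real) \<Rightarrow> (real^'d \<Rightarrow> real) \<Rightarrow> 'd tagged set \<Rightarrow>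
   (real^'d \<Rightarrow> real) \<Rightarrow> 'd tagged \<Rightarrow> real" where
  "estimator_sq A r c T v t =
     (mesh_size t)\<^sup>2 * (L2norm (elem t) (\<lambda>x. r x + div_flux A (elem t) v x - c x))\<^sup>2
     + mesh_size t * jump_sq A T v (elem t)"

text \<open>In \<open>eta_sq A f b T v S\<close> and \<open>zeta_sq A g b w T v S\<close>, \<open>T\<close> is the mesh, \<open>S \<subseteq> T\<close> the set of
  elements summed over, and \<open>w\<close> the function at which the dual problem is linearised.\<close>

definition eta_sq ::
  "(real^'d \<Rightarrow> real^'d^'d) \<Rightarrow> (real^'d \<Rightarrow> real) \<Rightarrow> (real^'d \<Rightarrow> real \<Rightarrow> real) \<Rightarrow> 'd tagged set \<Rightarrow>
   (real^'d \<Rightarrow> real) \<Rightarrow> 'd tagged set \<Rightarrow> real" where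
  "eta_sq A f b T v S = (\<Sum>t\<in>S. estimator_sq A f (\<lambda>x. b x (v x)) T v t)"

definition zeta_sq ::
  "(real^'d \<Rightarrow> real^'d^'d) \<Rightarrow> (real^'d \<Rightarrow> real) \<Rightarrow> (real^'d \<Rightarrow> real \<Rightarrow> real) \<Rightarrow> (real^'d \<Rightarrow> real) \<Rightarrow>
   'd tagged set \<Rightarrow> (real^'d \<Rightarrow> real) \<Rightarrow> 'd tagged set \<Rightarrow> real" where
  "zeta_sq A g b w T v S = (\<Sum>t\<in>S. estimator_sq A g (\<lambda>x. deriv (b x) (w x) * v x) T v t)"

text \<open>Marking and refinement in one step of the algorithm, for the discrete primal solution \<open>uk\<close> and the
  approximate dual solution \<open>zk\<close> on \<open>T\<close>.\<close>

definition goafem_step ::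
  "(real^'d) set \<Rightarrow> (real^'d \<Rightarrow> real^'d^'d) \<Rightarrow> (real^'d \<Rightarrow> real \<Rightarrow> real) \<Rightarrow> (real^'d \<Rightarrow> real) \<Rightarrow>
   (real^'d \<Rightarrow> real) \<Rightarrow> real \<Rightarrow> (real^'d \<Rightarrow> real) \<Rightarrow> (real^'d \<Rightarrow> real) \<Rightarrow>
   'd tagged set \<Rightarrow> 'd tagged set \<Rightarrow> bool" where
  "goafem_step \<Omega> A b f g \<theta> uk zk T T' \<longleftrightarrow>
     (\<exists>Mp Md. Mp \<subseteq> T \<and> Md \<subseteq> T \<and>
        eta_sq A f b T uk Mp \<ge> \<theta>\<^sup>2 * eta_sq A f b T uk T \<and>
        zeta_sq A g b uk T zk Md \<ge> \<theta>\<^sup>2 * zeta_sq A g b uk T zk T \<and>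
        refine \<Omega> T (Mp \<union> Md) T')"

end

theory Submission
  imports Defs
begin

text \<open>Write \<open>e = u - u\<^sub>j\<close> and \<open>w = zh - zh\<^sub>j\<close>. Testing the limiting dual problem with \<open>e\<close> and using Galerkin
  orthogonality of \<open>e\<close> against \<open>zh\<^sub>j\<close> gives
  \<open>g(e) = a(e, w) + \<langle>b'(u) e, w\<rangle> + \<langle>b'(u) e - (b(u) - b(u\<^sub>j)), zh\<^sub>j\<rangle>\<close>.
  The first two terms are products of a primal and a dual error, the last one is quadratic in \<open>e\<close>
  because \<open>b'\<close> is Lipschitz and \<open>zh\<^sub>j\<close> is bounded. Poincare's inequality bounds everything by the
  squared energy norms of \<open>e\<close> and \<open>w\<close>, hence by the quasi-error.\<close>

section \<open>Smooth cutoff functions\<close>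

text \<open>The obstacle is that \<open>wgrad\<close> is a choice among all weak gradients, so even
  the gradient of a difference splits only almost everywhere, and only once weak gradients are known
  to be unique. Uniqueness is the fundamental lemma of the calculus of variations and calls for
  explicit smooth functions of compact support; hence the preparation on bumps. Poincare's
  inequality is proved for test functions, where integration by parts is classical, and passes to
  \<open>H10\<close>, which is by definition their closure. The resulting constant is (1/2 + K c)(1
  + 1/\<pi>). The 1/2 bounds the symmetric energy form; K = |B| + |\<Theta>| M bounds the reaction
  remainder; c is the Poincare constant divided by \<mu>0; and 1 + 1/\<pi> compensates for the
  weight \<pi> on the primal error in the quasi-error. None of them depends on j, because the
  pointwise bounds on the discrete solutions are uniform in j. The contraction is assumed, so the
  second inequality is its iteration.\<close>

lemma partial_deriv_eq:
  assumes "(f has_derivative D) (at x)"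
  shows "partial_deriv i f x = D (axis i 1)"
  using frechet_derivative_at[OF assms] by (simp add: partial_deriv_def)

lemma C_k_SucI:
  assumes "\<And>x. (f has_derivative D x) (at x)" "\<And>i. C_k k (\<lambda>x. D x (axis i 1))"
  shows "C_k (Suc k) f"
proof -
  have "partial_deriv i f = (\<lambda>x. D x (axis i 1))" for i
    using partial_deriv_eq[OF assms(1)] by auto
  then show ?thesis using assms by (auto simp: differentiable_def)
qed

lemma C_k_Suc_has_derivative:
  assumes "C_k (Suc k) f"
  shows "(f has_derivative frechet_derivative f (at x)) (at x)"
  using assms frechet_derivative_works by auto

lemma C_k_decrease: "C_k (Suc k) f \<Longrightarrow> C_k k f"
proof (induction k arbitrary: f)
  case 0
  then show ?case
    by (auto intro!: differentiable_imp_continuous_on simp: differentiable_on_def)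
qed simp

lemma C_k_imp_continuous: "C_k k f \<Longrightarrow> continuous_on UNIV f"
proof (induction k)
  case (Suc k)
  then show ?case using C_k_decrease by blast
qed simp

lemma C_k_const: "C_k k (\<lambda>x. c)"
proof (induction k arbitrary: c)
  case (Suc k)
  show ?case by (rule C_k_SucI[where D = "\<lambda>x h. 0"]) (auto intro: Suc)
qed simp

lemma C_k_add: "C_k k f \<Longrightarrow> C_k k g \<Longrightarrow> C_k k (\<lambda>x. f x + g x)"
proof (induction k arbitrary: f g)
  case 0
  then show ?case by (auto intro: continuous_on_add)
next
  case (Suc k)
  show ?case
  proof (rule C_k_SucI[where D = "\<lambda>x h. frechet_derivative f (at x) h + frechet_derivative g (at x) h"])
    show "((\<lambda>x. f x + g x) has_derivative
        (\<lambda>h. frechet_derivative f (at x) h + frechet_derivative g (at x) h)) (at x)" for x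
      by (intro has_derivative_add C_k_Suc_has_derivative[of k] Suc.prems)
    show "C_k k (\<lambda>x. frechet_derivative f (at x) (axis i 1) + frechet_derivative g (at x) (axis i 1))" for i
      unfolding partial_deriv_def[symmetric] using Suc.prems by (intro Suc.IH) auto
  qed
qed

lemma C_k_mult: "C_k k f \<Longrightarrow> C_k k g \<Longrightarrow> C_k k (\<lambda>x. f x * g x)"
proof (induction k arbitrary: f g)
  case 0
  then show ?case by (auto intro: continuous_on_mult)
next
  case (Suc k)
  show ?case
  proof (rule C_k_SucI[where D = "\<lambda>x h. f x * frechet_derivative g (at x) h + frechet_derivative f (at x) h * g x"])
    show "((\<lambda>x. f x * g x) has_derivative
        (\<lambda>h. f x * frechet_derivative g (at x) h + frechet_derivative f (at x) h * g x)) (at x)" for x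
      by (intro has_derivative_mult C_k_Suc_has_derivative[of k] Suc.prems)
    show "C_k k (\<lambda>x. f x * frechet_derivative g (at x) (axis i 1) + frechet_derivative f (at x) (axis i 1) * g x)" for i
      unfolding partial_deriv_def[symmetric]
      using Suc.prems C_k_decrease[OF Suc.prems(1)] C_k_decrease[OF Suc.prems(2)]
      by (intro C_k_add Suc.IH) auto
  qed
qed

lemma C_k_prod: "(\<And>i. i \<in> I \<Longrightarrow> C_k k (f i)) \<Longrightarrow> C_k k (\<lambda>x. \<Prod>i\<in>I. f i x)"
  by (induction I rule: infinite_finite_induct) (auto intro: C_k_const C_k_mult)

lemma C_k_diff: "C_k k f \<Longrightarrow> C_k k g \<Longrightarrow> C_k k (\<lambda>x. f x - g x)"
  using C_k_add[OF _ C_k_mult[OF C_k_const[of k "-1"]], of f g] by simp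

lemma C_k_component: "C_k k (\<lambda>x. x $ i)"
proof (cases k)
  case 0
  then show ?thesis by (simp add: continuous_on_component)
next
  case (Suc m)
  have "C_k (Suc m) (\<lambda>x. x $ i)"
    by (rule C_k_SucI[where D = "\<lambda>x h. h $ i"])
      (auto intro: bounded_linear_imp_has_derivative bounded_linear_vec_nth C_k_const)
  with Suc show ?thesis by simp
qed

text \<open>The classical exp(-c/t), extended by zero, is the case k = 0. The power of 1/t is
  carried along because differentiation produces such powers: the linear span of the family over k
  is closed under derivatives.\<close>

definition flat :: "real \<Rightarrow> nat \<Rightarrow> real \<Rightarrow> real" where
  "flat c k t = (if 0 < t then (1 / t) ^ k * exp (- c / t) else 0)"

lemma flat_over_tendsto_0:
  fixes c :: real
  assumes "0 < c"
  shows "((\<lambda>h. (1 / h) ^ k * exp (- c / h)) \<longlongrightarrow> 0) (at_right 0)"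
proof -
  have *: "((\<lambda>y::real. y ^ k / exp y) \<longlongrightarrow> 0) at_top"
    by (rule tendsto_power_div_exp_0)
  have "filterlim ((*) c) at_top at_top"
    using filterlim_tendsto_pos_mult_at_top[OF tendsto_const assms, of "\<lambda>y. y" at_top]
    by (simp add: filterlim_ident)
  from filterlim_compose[OF * this]
  have "((\<lambda>y. (c * y) ^ k / exp (c * y)) \<longlongrightarrow> 0) at_top" .
  \<comment> \<open>The exponential limit is taken at c y; the factor removes the c^k that this
    leaves in the numerator. Then y = 1/h gives the claim.\<close>
  from tendsto_mult_left[OF this, of "1 / c ^ k"]
  have "((\<lambda>y. y ^ k * exp (- (c * y))) \<longlongrightarrow> 0) at_top"
    using assms by (simp add: power_mult_distrib exp_minus field_simps)
  from filterlim_compose[OF this filterlim_inverse_at_top_right]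
  show ?thesis by (simp add: divide_inverse)
qed

lemma flat_has_derivative:
  assumes "0 < c"
  shows "(flat c k has_field_derivative (c * flat c (k + 2) t - real k * flat c (k + 1) t)) (at t)"
proof -
  consider "t < 0" | "t = 0" | "0 < t" by linarith
  then show ?thesis
  proof cases
    case 1
    have "((\<lambda>_. 0) has_field_derivative 0) (at t)" by simp
    then have "(flat c k has_field_derivative 0) (at t)"
      by (rule has_field_derivative_transform_within_open[where S = "{..<0}"])
        (use 1 in \<open>auto simp: flat_def\<close>)
    then show ?thesis using 1 by (simp add: flat_def)
  next
    case 2
    \<comment> \<open>At the origin the difference quotient raises the exponent by one: for h > 0 it
      equals \<open>flat c (Suc k) h\<close>, and for h < 0 it vanishes.\<close>
    have "((\<lambda>h. flat c k h / h) \<longlongrightarrow> 0) (at_right 0)"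
      using flat_over_tendsto_0[OF assms, of "Suc k"]
      by (rule Lim_transform_eventually)
        (auto simp: eventually_at_right_less flat_def eventually_at_topological intro!: exI[of _ UNIV])
    moreover have "((\<lambda>h. flat c k h / h) \<longlongrightarrow> 0) (at_left 0)"
      by (rule Lim_transform_eventually[OF tendsto_const])
        (auto simp: flat_def eventually_at_topological intro!: exI[of _ UNIV])
    ultimately have "((\<lambda>h. flat c k h / h) \<longlongrightarrow> 0) (at 0)"
      by (simp add: filterlim_split_at)
    then show ?thesis using 2 by (simp add: DERIV_def flat_def)
  next
    case 3
    have inv: "((\<lambda>t. 1 / t) has_field_derivative - ((1 / t) ^ 2)) (at t)"
      using 3 by (auto intro!: derivative_eq_intros simp: power2_eq_square)
    have pow: "((\<lambda>t. (1 / t) ^ k) has_field_derivative - (real k * (1 / t) ^ (k + 1))) (at t)"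
      using DERIV_power[OF inv, of k] by (cases k) (simp_all add: power2_eq_square mult_ac)
    have "((\<lambda>t. exp (- c / t)) has_field_derivative c * (1 / t) ^ 2 * exp (- c / t)) (at t)"
      using 3 by (auto intro!: derivative_eq_intros simp: power2_eq_square)
    from DERIV_mult[OF pow this]
    have "((\<lambda>t. (1 / t) ^ k * exp (- c / t)) has_field_derivative
        (c * ((1 / t) ^ (k + 2) * exp (- c / t)) - real k * ((1 / t) ^ (k + 1) * exp (- c / t)))) (at t)"
      by (simp add: algebra_simps power_add power2_eq_square)
    then have "(flat c k has_field_derivative
        (c * ((1 / t) ^ (k + 2) * exp (- c / t)) - real k * ((1 / t) ^ (k + 1) * exp (- c / t)))) (at t)"
      by (rule has_field_derivative_transform_within_open[where S = "{0<..}"])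
        (use 3 in \<open>auto simp: flat_def\<close>)
    then show ?thesis using 3 by (simp add: flat_def)
  qed
qed

text \<open>The induction on the order generalises over \<open>k\<close>, since one derivative leads
  to the exponents k + 1 and k + 2. The affine argument accommodates both faces of a slab, x_i - a_i
  and b_i - x_i.\<close>

lemma C_k_flat:
  fixes i :: "'d::finite"
  assumes "0 < c"
  shows "C_k m (\<lambda>x. flat c k (\<alpha> * x $ i + \<beta>))"
proof (induction m arbitrary: k)
  case 0
  have "continuous_on UNIV (flat c k)"
    using flat_has_derivative[OF assms] by (meson DERIV_isCont continuous_at_imp_continuous_on)
  then have "continuous_on UNIV (flat c k \<circ> (\<lambda>x. \<alpha> * x $ i + \<beta>))"
    by (intro continuous_on_compose continuous_intros) (auto intro: continuous_on_subset)
  then show ?case by (simp add: comp_def)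
next
  case (Suc m)
  define F' where "F' t = c * flat c (k + 2) t - real k * flat c (k + 1) t" for t
  have d: "((\<lambda>x. flat c k (\<alpha> * x $ i + \<beta>)) has_derivative
      (\<lambda>h. F' (\<alpha> * x $ i + \<beta>) * (\<alpha> * h $ i))) (at x)" for x :: "real^'d"
  proof -
    have "((\<lambda>x::real^'d. \<alpha> * x $ i + \<beta>) has_derivative (\<lambda>h. \<alpha> * h $ i)) (at x)"
      by (auto intro!: derivative_eq_intros bounded_linear_imp_has_derivative bounded_linear_vec_nth)
    moreover have "(flat c k has_derivative (*) (F' (\<alpha> * x $ i + \<beta>))) (at (\<alpha> * x $ i + \<beta>))"
      using flat_has_derivative[OF assms] by (simp add: has_field_derivative_def F'_def)
    ultimately show ?thesis
      using diff_chain_at by (fastforce simp: comp_def)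
  qed
  show ?case
    by (rule C_k_SucI[OF d]) (unfold F'_def, intro C_k_mult C_k_diff C_k_const Suc)
qed

text \<open>Every factor exp(-c/t) tends to 1 as c decreases to 0, so \<open>c\<close> steers the
  bump towards the indicator of the open box without moving its support.\<close>

definition box_bump :: "real \<Rightarrow> real^'d \<Rightarrow> real^'d \<Rightarrow> real^'d \<Rightarrow> real" where
  "box_bump c a b x = (\<Prod>i\<in>UNIV. flat c 0 (x $ i - a $ i) * flat c 0 (b $ i - x $ i))"

lemma C_k_box_bump: "0 < c \<Longrightarrow> C_k k (box_bump c a b)"
  unfolding box_bump_def[abs_def]
  using C_k_flat[of c k 0 1 _ "- a $ _"] C_k_flat[of c k 0 "-1" _ "b $ _"]
  by (intro C_k_prod C_k_mult) simp_all

lemma box_bump_bounds: "0 < c \<Longrightarrow> 0 \<le> box_bump c a b x \<and> box_bump c a b x \<le> 1"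
  unfolding box_bump_def flat_def
  by (auto intro!: prod_nonneg prod_le_1 mult_le_one simp: field_simps)

lemma box_bump_eq_0:
  assumes "x \<notin> box a b"
  shows "box_bump c a b x = 0"
proof -
  obtain i where "\<not> (a $ i < x $ i \<and> x $ i < b $ i)"
    using assms by (auto simp: mem_box_cart)
  then have "flat c 0 (x $ i - a $ i) * flat c 0 (b $ i - x $ i) = 0"
    by (auto simp: flat_def)
  then show ?thesis
    unfolding box_bump_def by (intro prod_zero) auto
qed

lemma box_bump_tendsto:
  "(\<lambda>m. box_bump (1 / real (Suc m)) a b x) \<longlonglongrightarrow> indicat_real (box a b) x"
proof (cases "x \<in> box a b")
  case True
  have "(\<lambda>m. exp (- (1 / real (Suc m)) / d)) \<longlonglongrightarrow> exp (- 0 / d)" if "0 < d" for d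
    using that by (intro tendsto_intros LIMSEQ_Suc[OF lim_1_over_n]) auto
  then have "(\<lambda>m. flat (1 / real (Suc m)) 0 d) \<longlonglongrightarrow> 1" if "0 < d" for d
    using that by (simp add: flat_def)
  then have "(\<lambda>m. box_bump (1 / real (Suc m)) a b x) \<longlonglongrightarrow> (\<Prod>i\<in>(UNIV::'a set). 1 * 1)"
    unfolding box_bump_def using True by (intro tendsto_prod tendsto_mult) (auto simp: mem_box_cart)
  then show ?thesis using True by simp
qed (simp add: box_bump_eq_0)

section \<open>Algebra of test functions and their partial derivatives\<close>

lemma test_functionI:
  assumes "\<And>k. C_k k \<phi>" "compact K" "K \<subseteq> \<Omega>" "\<And>x. x \<notin> K \<Longrightarrow> \<phi> x = 0"
  shows "\<phi> \<in> test_functions \<Omega>"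
proof -
  have "{x. \<phi> x \<noteq> 0} \<subseteq> K" using assms(4) by blast
  then have "closure {x. \<phi> x \<noteq> 0} \<subseteq> K" "bounded {x. \<phi> x \<noteq> 0}"
    using assms(2) by (simp_all add: closure_minimal compact_imp_closed bounded_subset[OF compact_imp_bounded])
  then show ?thesis
    unfolding test_functions_def using assms(1,3) by (auto simp: compact_closure)
qed

lemma test_functionE:
  assumes "\<phi> \<in> test_functions \<Omega>"
  obtains K where "\<And>k. C_k k \<phi>" "compact K" "K \<subseteq> \<Omega>" "\<And>x. x \<notin> K \<Longrightarrow> \<phi> x = 0"
  using assms that[of "closure {x. \<phi> x \<noteq> 0}"] closure_subset[of "{x. \<phi> x \<noteq> 0}"]
  unfolding test_functions_def by blast

lemma test_functions_diff:
  assumes "\<phi> \<in> test_functions \<Omega>" "\<psi> \<in> test_functions \<Omega>"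
  shows "(\<lambda>x. \<phi> x - \<psi> x) \<in> test_functions \<Omega>"
proof -
  obtain K L where "\<And>k. C_k k \<phi>" "compact K" "K \<subseteq> \<Omega>" "\<And>x. x \<notin> K \<Longrightarrow> \<phi> x = 0"
    "\<And>k. C_k k \<psi>" "compact L" "L \<subseteq> \<Omega>" "\<And>x. x \<notin> L \<Longrightarrow> \<psi> x = 0"
    using assms by (metis test_functionE)
  then show ?thesis
    by (intro test_functionI[of _ "K \<union> L"] C_k_diff) auto
qed

text \<open>The compact support comes from \<phi> alone, so \<open>h\<close> may be a coordinate
  function, as the proof of Poincare's inequality requires.\<close>

lemma test_functions_mult:
  assumes "\<And>k. C_k k h" "\<phi> \<in> test_functions \<Omega>"
  shows "(\<lambda>x. h x * \<phi> x) \<in> test_functions \<Omega>"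
proof -
  obtain K where "\<And>k. C_k k \<phi>" "compact K" "K \<subseteq> \<Omega>" "\<And>x. x \<notin> K \<Longrightarrow> \<phi> x = 0"
    using assms by (metis test_functionE)
  then show ?thesis using assms(1)
    by (intro test_functionI[of _ K] C_k_mult) auto
qed

lemma test_function_C_k: "\<phi> \<in> test_functions \<Omega> \<Longrightarrow> C_k k \<phi>"
  by (simp add: test_functions_def)

lemma continuous_partial_deriv: "C_k 1 \<phi> \<Longrightarrow> continuous_on UNIV (partial_deriv i \<phi>)"
  by simp

lemma partial_deriv_mult:
  assumes "C_k 1 f" "C_k 1 g"
  shows "partial_deriv i (\<lambda>x. f x * g x) x = f x * partial_deriv i g x + partial_deriv i f x * g x"
  using partial_deriv_eq[OF has_derivative_mult[OF C_k_Suc_has_derivative[of 0 f x] C_k_Suc_has_derivative[of 0 g x]]] assms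
  by (simp add: partial_deriv_def)

lemma partial_deriv_component: "partial_deriv i (\<lambda>x. x $ i) x = 1"
  by (subst partial_deriv_eq[where D = "\<lambda>h. h $ i"])
    (auto intro: bounded_linear_imp_has_derivative bounded_linear_vec_nth)

lemma partial_deriv_outside:
  assumes "closed K" "\<And>x. x \<notin> K \<Longrightarrow> \<phi> x = 0" "x \<notin> K"
  shows "partial_deriv i \<phi> x = 0"
proof -
  have "((\<lambda>_. 0) has_derivative (\<lambda>_. 0)) (at x)" by simp
  then have "(\<phi> has_derivative (\<lambda>_. 0)) (at x)"
    by (rule has_derivative_transform_within_open[where s = "- K"]) (use assms in auto)
  then show ?thesis by (simp add: partial_deriv_eq)
qed

section \<open>Square integrable functions and weak gradients\<close>

lemma L2D:
  assumes "v \<in> L2 S"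
  shows "v \<in> borel_measurable (lebesgue_on S)" "integrable (lebesgue_on S) (\<lambda>x. (norm (v x))\<^sup>2)"
  using assms by (auto simp: L2_def)

lemma L2_bound:
  assumes "v \<in> L2 S" "w \<in> borel_measurable (lebesgue_on S)" "\<And>x. x \<in> S \<Longrightarrow> norm (w x) \<le> B * norm (v x)"
  shows "w \<in> L2 S"
proof -
  have "integrable (lebesgue_on S) (\<lambda>x. (norm (w x))\<^sup>2)"
  proof (rule Bochner_Integration.integrable_bound)
    show "integrable (lebesgue_on S) (\<lambda>x. B\<^sup>2 * (norm (v x))\<^sup>2)"
      using L2D[OF assms(1)] by simp
    show "(\<lambda>x. (norm (w x))\<^sup>2) \<in> borel_measurable (lebesgue_on S)"
      using assms(2) by simp
    have "norm ((norm (w x))\<^sup>2) \<le> norm (B\<^sup>2 * (norm (v x))\<^sup>2)" if "x \<in> S" for x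
      using power_mono[OF assms(3)[OF that] norm_ge_zero, of 2] unfolding power_mult_distrib by simp
    then show "AE x in lebesgue_on S. norm ((norm (w x))\<^sup>2) \<le> norm (B\<^sup>2 * (norm (v x))\<^sup>2)"
      by (intro AE_I2) (simp add: space_restrict_space)
  qed
  with assms(2) show ?thesis by (simp add: L2_def)
qed

lemma L2_bounded_linear:
  assumes "bounded_linear h" "v \<in> L2 S"
  shows "(\<lambda>x. h (v x)) \<in> L2 S"
proof -
  interpret bounded_linear h by fact
  obtain K where K: "\<And>x. norm (h x) \<le> norm x * K" using bounded by blast
  have [measurable]: "h \<in> borel_measurable borel"
    by (intro borel_measurable_continuous_onI linear_continuous_on assms)
  have [measurable]: "v \<in> borel_measurable (lebesgue_on S)" using L2D[OF assms(2)] by blast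
  show ?thesis
    by (rule L2_bound[OF assms(2), where B = K]) (measurable, metis K mult.commute)
qed

text \<open>The inner product is dominated by the sum of the two squares, so integrability follows
  without Hoelder's inequality.\<close>

lemma L2_inner_integrable:
  assumes "v \<in> L2 S" "w \<in> L2 S"
  shows "integrable (lebesgue_on S) (\<lambda>x. v x \<bullet> w x)"
proof (rule Bochner_Integration.integrable_bound)
  show "integrable (lebesgue_on S) (\<lambda>x. (norm (v x))\<^sup>2 + (norm (w x))\<^sup>2)"
    using L2D[OF assms(1)] L2D[OF assms(2)] by simp
  show "(\<lambda>x. v x \<bullet> w x) \<in> borel_measurable (lebesgue_on S)"
    using L2D[OF assms(1)] L2D[OF assms(2)] by simp
  have "\<bar>a \<bullet> b\<bar> \<le> (norm a)\<^sup>2 + (norm b)\<^sup>2" for a b :: 'b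
    using Cauchy_Schwarz_ineq2[of a b] sum_squares_bound[of "norm a" "norm b"]
      mult_nonneg_nonneg[of "norm a" "norm b"] by simp
  then show "AE x in lebesgue_on S. norm (v x \<bullet> w x) \<le> norm ((norm (v x))\<^sup>2 + (norm (w x))\<^sup>2)"
    by simp
qed

lemma L2_mult_integrable:
  fixes v w :: "real^'d \<Rightarrow> real"
  shows "v \<in> L2 S \<Longrightarrow> w \<in> L2 S \<Longrightarrow> integrable (lebesgue_on S) (\<lambda>x. v x * w x)"
  using L2_inner_integrable[of v S w] by simp

text \<open>Parallelogram law with one square dropped. It stands in for the triangle inequality of
  the integral norms throughout.\<close>

lemma norm_add_sq_le: "(norm (a + b))\<^sup>2 \<le> 2 * (norm a)\<^sup>2 + 2 * (norm b)\<^sup>2"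
  for a b :: "'a::real_inner"
proof -
  have "(norm (a + b))\<^sup>2 + (norm (a - b))\<^sup>2 = 2 * (norm a)\<^sup>2 + 2 * (norm b)\<^sup>2"
    by (simp add: power2_norm_eq_inner inner_simps inner_commute)
  then show ?thesis by (smt (verit) zero_le_power2)
qed

lemma L2_add:
  assumes "v \<in> L2 S" "w \<in> L2 S"
  shows "(\<lambda>x. v x + w x) \<in> L2 S"
proof -
  have "integrable (lebesgue_on S) (\<lambda>x. 2 * (norm (v x))\<^sup>2 + 2 * (norm (w x))\<^sup>2)"
    using L2D[OF assms(1)] L2D[OF assms(2)] by simp
  then have "integrable (lebesgue_on S) (\<lambda>x. (norm (v x + w x))\<^sup>2)"
    by (rule Bochner_Integration.integrable_bound)
      (use L2D[OF assms(1)] L2D[OF assms(2)] in \<open>auto intro!: AE_I2 simp: norm_add_sq_le\<close>)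
  then show ?thesis using L2D[OF assms(1)] L2D[OF assms(2)] by (auto simp: L2_def)
qed

lemma L2_diff:
  assumes "v \<in> L2 S" "w \<in> L2 S"
  shows "(\<lambda>x. v x - w x) \<in> L2 S"
  using L2_add[OF assms(1) L2_bounded_linear[OF bounded_linear_minus[OF bounded_linear_ident] assms(2)]] by simp

lemma L2norm_sq: "(L2norm S v)\<^sup>2 = (LINT x|lebesgue_on S. (norm (v x))\<^sup>2)"
  by (simp add: L2norm_def)

lemma borel_measurable_continuous_lebesgue_on:
  assumes "continuous_on UNIV h"
  shows "h \<in> borel_measurable (lebesgue_on S)"
  using assms by (intro measurable_restrict_space1 measurable_completion)
    (simp add: borel_measurable_continuous_onI)

section \<open>Square integrability and weak gradients on a bounded open set\<close>

locale bounded_open_set =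
  fixes \<Omega> :: "(real^'d) set"
  assumes open_\<Omega>: "open \<Omega>" and bounded_\<Omega>: "bounded \<Omega>"
begin

lemma \<Omega>_lmeasurable: "\<Omega> \<in> lmeasurable"
  by (simp add: open_\<Omega> bounded_\<Omega> lmeasurable_open)

lemma \<Omega>_sets: "\<Omega> \<in> sets lebesgue" "\<Omega> \<inter> space lebesgue \<in> sets lebesgue"
  using \<Omega>_lmeasurable by (auto simp: fmeasurableD)

text \<open>Continuity on the whole space makes h bounded on the compact closure of \<Omega>, and
  \<Omega> has finite measure.\<close>

lemma continuous_in_L2:
  fixes h :: "real^'d \<Rightarrow> 'b::euclidean_space"
  assumes "continuous_on UNIV h"
  shows "h \<in> L2 \<Omega>"
proof -
  interpret finite_measure "lebesgue_on \<Omega>"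
    using finite_measure_lebesgue_on \<Omega>_lmeasurable by blast
  have "bounded (h ` closure \<Omega>)"
    using assms bounded_\<Omega> by (intro compact_imp_bounded compact_continuous_image)
      (auto intro: continuous_on_subset simp: compact_closure)
  then obtain B where B: "\<And>x. x \<in> \<Omega> \<Longrightarrow> norm (h x) \<le> B"
    using closure_subset[of \<Omega>] unfolding bounded_iff by blast
  have [measurable]: "h \<in> borel_measurable (lebesgue_on \<Omega>)"
    using borel_measurable_continuous_lebesgue_on[OF assms] .
  have "integrable (lebesgue_on \<Omega>) (\<lambda>x. (norm (h x))\<^sup>2)"
    by (rule integrable_const_bound[where B = "B\<^sup>2"])
      (auto intro!: AE_I2 power_mono B simp: space_restrict_space)
  then show ?thesis by (simp add: L2_def)
qed

lemma L2_integrable: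
  fixes v :: "real^'d \<Rightarrow> real"
  assumes "v \<in> L2 \<Omega>"
  shows "integrable (lebesgue_on \<Omega>) v"
  using L2_mult_integrable[OF assms continuous_in_L2[of "\<lambda>_. 1"]] by simp

text \<open>The bumps converge to the indicator of the open box and are bounded by 1, so |F|
  dominates. The closed box must lie in \<Omega> because it is the compact set that makes each bump
  a test function.\<close>

lemma box_integral_eq_0:
  assumes F: "integrable (lebesgue_on \<Omega>) F"
    and zero: "\<And>\<phi>. \<phi> \<in> test_functions \<Omega> \<Longrightarrow> (LINT x|lebesgue_on \<Omega>. F x * \<phi> x) = 0"
    and sub: "cbox a b \<subseteq> \<Omega>"
  shows "(LINT x|lebesgue_on \<Omega>. F x * indicator (box a b) x) = 0"
proof -
  let ?\<phi> = "\<lambda>m. box_bump (1 / real (Suc m)) a b"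
  have cont: "continuous_on UNIV (?\<phi> m)" for m
    by (rule C_k_imp_continuous[OF C_k_box_bump]) simp
  have [measurable]: "F \<in> borel_measurable (lebesgue_on \<Omega>)" using F by simp
  have "?\<phi> m \<in> test_functions \<Omega>" for m
    by (rule test_functionI[of _ "cbox a b"])
      (use sub box_subset_cbox[of a b] in \<open>auto intro!: C_k_box_bump box_bump_eq_0\<close>)
  then have eq: "(LINT x|lebesgue_on \<Omega>. F x * ?\<phi> m x) = 0" for m by (rule zero)
  have "(\<lambda>m. LINT x|lebesgue_on \<Omega>. F x * ?\<phi> m x)
      \<longlonglongrightarrow> (LINT x|lebesgue_on \<Omega>. F x * indicator (box a b) x)"
  proof (rule integral_dominated_convergence[where w = "\<lambda>x. norm (F x)"])
    show "AE x in lebesgue_on \<Omega>. (\<lambda>m. F x * ?\<phi> m x) \<longlonglongrightarrow> F x * indicator (box a b) x"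
      by (intro AE_I2 tendsto_mult tendsto_const box_bump_tendsto)
    have "norm (F x * ?\<phi> m x) \<le> norm (F x)" for m x
      using box_bump_bounds[of "1 / real (Suc m)" a b x]
      by (auto simp: abs_mult intro!: mult_left_le)
    then show "AE x in lebesgue_on \<Omega>. norm (F x * ?\<phi> m x) \<le> norm (F x)" for m by simp
    show "(\<lambda>x. F x * ?\<phi> m x) \<in> borel_measurable (lebesgue_on \<Omega>)" for m
      using borel_measurable_continuous_lebesgue_on[OF cont] by measurable
    have "box a b \<in> sets lebesgue" by simp
    then have "indicat_real (box a b) \<in> borel_measurable (lebesgue_on \<Omega>)"
      by (intro measurable_restrict_space1 borel_measurable_indicator)
    then show "(\<lambda>x. F x * indicator (box a b) x) \<in> borel_measurable (lebesgue_on \<Omega>)"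
      by measurable
  qed (use F in simp)
  then show ?thesis unfolding eq by (simp add: LIMSEQ_const_iff)
qed

text \<open>By Lebesgue differentiation on cubes, whose indicators are limits of smooth bumps.\<close>

lemma AE_eq_0_if_test_integrals_0:
  assumes F: "integrable (lebesgue_on \<Omega>) F"
    and zero: "\<And>\<phi>. \<phi> \<in> test_functions \<Omega> \<Longrightarrow> (LINT x|lebesgue_on \<Omega>. F x * \<phi> x) = 0"
  shows "AE x in lebesgue_on \<Omega>. F x = 0"
proof -
  \<comment> \<open>Extension by zero makes the differentiation theorem on the whole space
    applicable.\<close>
  define f where "f x = (if x \<in> \<Omega> then F x else 0)" for x
  have int: "integrable lebesgue f"
    using Lebesgue_Measure.integrable_restrict_UNIV[of \<Omega> F] \<Omega>_sets(1) F by (simp add: f_def[abs_def])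
  then have si: "set_integrable lebesgue S f" if "S \<in> sets lebesgue" for S
    using that unfolding set_integrable_def by (rule integrable_mult_indicator[rotated])
  have "f integrable_on cbox a b" for a b
    using set_lebesgue_integral_eq_integral(1)[OF si] by simp
  then obtain N where N: "negligible N"
    "\<And>x e. \<lbrakk>x \<notin> N; 0 < e\<rbrakk> \<Longrightarrow> \<exists>d>0. \<forall>h. 0 < h \<and> h < d \<longrightarrow>
       norm (integral (cbox x (x + h *\<^sub>R One)) f /\<^sub>R h ^ DIM(real^'d) - f x) < e"
    using integrable_ccontinuous_explicit by blast
  \<comment> \<open>Differentiation averages over closed cubes, while the bumps see the open box;
    the boundary contributes nothing to the integral.\<close>
  have box0: "integral (cbox a b) f = 0" if "cbox a b \<subseteq> \<Omega>" for a b
  proof -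
    have "integral (cbox a b) f = (LINT x:box a b|lebesgue. f x)"
      using set_lebesgue_integral_eq_integral(2)[OF si] by (simp add: integral_open_interval)
    also have "\<dots> = (LINT x|lebesgue. (if x \<in> \<Omega> then F x * indicator (box a b) x else 0))"
      unfolding set_lebesgue_integral_def f_def by (intro Bochner_Integration.integral_cong) auto
    also have "\<dots> = 0"
      by (simp add: Lebesgue_Measure.integral_restrict_UNIV[OF \<Omega>_sets(1)] box_integral_eq_0[OF F zero that])
    finally show ?thesis .
  qed
  have "F x = 0" if x: "x \<in> \<Omega>" "x \<notin> N" for x
  proof (rule ccontr)
    assume "F x \<noteq> 0"
    \<comment> \<open>With tolerance |F x|, a vanishing average over one small cube already gives |F
      x| < |F x|.\<close>
    then obtain d where d: "d > 0" "\<And>h. 0 < h \<and> h < d \<Longrightarrow>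
        norm (integral (cbox x (x + h *\<^sub>R One)) f /\<^sub>R h ^ DIM(real^'d) - f x) < \<bar>F x\<bar>"
      using N(2)[OF x(2), of "\<bar>F x\<bar>"] by auto
    obtain r where r: "r > 0" "cball x r \<subseteq> \<Omega>"
      using open_\<Omega> x(1) open_contains_cball by blast
    \<comment> \<open>The cube of side h at x has diameter h times the norm of \<open>One\<close>,
      so it stays in the ball of radius r. Adding 1 keeps the denominator visibly positive.\<close>
    define h where "h = min (d / 2) (r / (1 + norm (One :: real^'d)))"
    have pos: "0 < 1 + norm (One :: real^'d)" by (simp add: add_pos_nonneg)
    have h: "0 < h" "h < d" "h * norm (One :: real^'d) \<le> r"
    proof -
      show "0 < h" "h < d" using d(1) r(1) pos by (auto simp: h_def)
      have "h * norm (One :: real^'d) \<le> h * (1 + norm (One :: real^'d))"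
        using \<open>0 < h\<close> by (intro mult_left_mono) auto
      also have "\<dots> \<le> r"
        using min.cobounded2[of "d / 2" "r / (1 + norm (One :: real^'d))"]
        unfolding h_def pos_le_divide_eq[OF pos] .
      finally show "h * norm (One :: real^'d) \<le> r" .
    qed
    have "cbox x (x + h *\<^sub>R One) \<subseteq> cball x r"
    proof
      fix y assume y: "y \<in> cbox x (x + h *\<^sub>R One)"
      have "norm (y - x) \<le> norm (h *\<^sub>R One :: real^'d)"
      proof (rule norm_le_componentwise)
        fix b :: "real^'d" assume b: "b \<in> Basis"
        with y have "x \<bullet> b \<le> y \<bullet> b" "y \<bullet> b \<le> x \<bullet> b + h * (One \<bullet> b)"
          by (auto simp: mem_box inner_simps)
        with b h(1) show "\<bar>(y - x) \<bullet> b\<bar> \<le> \<bar>(h *\<^sub>R One) \<bullet> b\<bar>"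
          by (simp add: inner_diff_left)
      qed
      then show "y \<in> cball x r" using h by (simp add: dist_norm norm_minus_commute)
    qed
    then have "integral (cbox x (x + h *\<^sub>R One)) f = 0" using r box0 by blast
    with d(2)[of h] h x show False by (simp add: f_def)
  qed
  moreover have "AE x in lebesgue. x \<notin> N"
    using N(1) by (simp add: negligible_iff_null_sets AE_not_in)
  ultimately show ?thesis
    by (auto simp: AE_restrict_space_iff[OF \<Omega>_sets(2)] elim!: eventually_mono)
qed

text \<open>Both gradients have the same integrals against every test function, so each component of
  the difference vanishes almost everywhere; there are finitely many components.\<close>

lemma weak_gradient_unique:
  assumes "weak_gradient \<Omega> v G" "weak_gradient \<Omega> v G'"
  shows "AE x in lebesgue_on \<Omega>. G x = G' x"
proof -
  have L2: "(\<lambda>x. G x $ i) \<in> L2 \<Omega>" "(\<lambda>x. G' x $ i) \<in> L2 \<Omega>" for i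
    using assms by (auto simp: weak_gradient_def intro: L2_bounded_linear[OF bounded_linear_vec_nth])
  have "AE x in lebesgue_on \<Omega>. G x $ i - G' x $ i = 0" for i
  proof (rule AE_eq_0_if_test_integrals_0)
    show "integrable (lebesgue_on \<Omega>) (\<lambda>x. G x $ i - G' x $ i)"
      using L2_integrable[OF L2(1)] L2_integrable[OF L2(2)] by simp
    fix \<phi> assume \<phi>: "\<phi> \<in> test_functions \<Omega>"
    then have "\<phi> \<in> L2 \<Omega>" by (intro continuous_in_L2 C_k_imp_continuous[OF test_function_C_k])
    then have "(LINT x|lebesgue_on \<Omega>. (G x $ i - G' x $ i) * \<phi> x)
        = (LINT x|lebesgue_on \<Omega>. G x $ i * \<phi> x) - (LINT x|lebesgue_on \<Omega>. G' x $ i * \<phi> x)"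
      using L2_mult_integrable[OF L2(1)] L2_mult_integrable[OF L2(2)] by (simp add: left_diff_distrib)
    then show "(LINT x|lebesgue_on \<Omega>. (G x $ i - G' x $ i) * \<phi> x) = 0"
      using assms \<phi> unfolding weak_gradient_def by simp
  qed
  then have "AE x in lebesgue_on \<Omega>. \<forall>i\<in>UNIV. G x $ i - G' x $ i = 0"
    by (intro AE_finite_allI) auto
  then show ?thesis by eventually_elim (simp add: vec_eq_iff)
qed

lemma wgrad_weak_gradient: "v \<in> H1 \<Omega> \<Longrightarrow> weak_gradient \<Omega> v (wgrad \<Omega> v)"
  unfolding H1_def wgrad_def mem_Collect_eq by (rule someI_ex[of "weak_gradient \<Omega> v"])

lemma weak_gradient_diff:
  assumes "weak_gradient \<Omega> v G" "weak_gradient \<Omega> w H"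
  shows "weak_gradient \<Omega> (\<lambda>x. v x - w x) (\<lambda>x. G x - H x)"
  unfolding weak_gradient_def
proof (intro conjI ballI allI)
  have v: "v \<in> L2 \<Omega>" "w \<in> L2 \<Omega>" "G \<in> L2 \<Omega>" "H \<in> L2 \<Omega>"
    using assms by (auto simp: weak_gradient_def)
  then show "(\<lambda>x. v x - w x) \<in> L2 \<Omega>" "(\<lambda>x. G x - H x) \<in> L2 \<Omega>"
    by (auto intro: L2_diff)
  fix \<phi> i assume \<phi>: "\<phi> \<in> test_functions \<Omega>"
  then have \<phi>L: "\<phi> \<in> L2 \<Omega>" "partial_deriv i \<phi> \<in> L2 \<Omega>"
    by (auto intro!: continuous_in_L2 C_k_imp_continuous[OF test_function_C_k] continuous_partial_deriv
        test_function_C_k simp del: One_nat_def)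
  have "(\<lambda>x. G x $ i) \<in> L2 \<Omega>" "(\<lambda>x. H x $ i) \<in> L2 \<Omega>"
    using v by (auto intro: L2_bounded_linear[OF bounded_linear_vec_nth])
  then have "(LINT x|lebesgue_on \<Omega>. (v x - w x) * partial_deriv i \<phi> x)
      = (LINT x|lebesgue_on \<Omega>. v x * partial_deriv i \<phi> x) - (LINT x|lebesgue_on \<Omega>. w x * partial_deriv i \<phi> x)"
    "(LINT x|lebesgue_on \<Omega>. (G x - H x) $ i * \<phi> x)
      = (LINT x|lebesgue_on \<Omega>. G x $ i * \<phi> x) - (LINT x|lebesgue_on \<Omega>. H x $ i * \<phi> x)"
    using v \<phi>L by (simp_all add: left_diff_distrib L2_mult_integrable)
  then show "(LINT x|lebesgue_on \<Omega>. (v x - w x) * partial_deriv i \<phi> x)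
      = - (LINT x|lebesgue_on \<Omega>. (G x - H x) $ i * \<phi> x)"
    using assms \<phi> unfolding weak_gradient_def by simp
qed

lemma H1_diff: "v \<in> H1 \<Omega> \<Longrightarrow> w \<in> H1 \<Omega> \<Longrightarrow> (\<lambda>x. v x - w x) \<in> H1 \<Omega>"
  using weak_gradient_diff unfolding H1_def by blast

text \<open>Since \<open>wgrad\<close> is chosen separately for each function, linearity cannot hold
  pointwise; uniqueness of weak gradients restores it up to null sets.\<close>

lemma wgrad_diff:
  assumes "v \<in> H1 \<Omega>" "w \<in> H1 \<Omega>"
  shows "AE x in lebesgue_on \<Omega>. wgrad \<Omega> (\<lambda>x. v x - w x) x = wgrad \<Omega> v x - wgrad \<Omega> w x"
  using assms by (intro weak_gradient_unique[OF wgrad_weak_gradient weak_gradient_diff] H1_diff wgrad_weak_gradient)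

lemma H1_in_L2: "v \<in> H1 \<Omega> \<Longrightarrow> v \<in> L2 \<Omega>" "v \<in> H1 \<Omega> \<Longrightarrow> wgrad \<Omega> v \<in> L2 \<Omega>"
  using wgrad_weak_gradient[of v] by (auto simp: weak_gradient_def)

end

section \<open>Integration by parts and the Poincare inequality\<close>

lemma DERIV_along_axis:
  assumes "C_k 1 \<psi>"
  shows "((\<lambda>t. \<psi> (x + t *\<^sub>R axis i 1)) has_field_derivative partial_deriv i \<psi> (x + t *\<^sub>R axis i 1)) (at t)"
proof -
  let ?D = "frechet_derivative \<psi> (at (x + t *\<^sub>R axis i 1))"
  have D: "(\<psi> has_derivative ?D) (at (x + t *\<^sub>R axis i 1))"
    using C_k_Suc_has_derivative[of 0 \<psi>] assms by simp
  then interpret bounded_linear ?D by (rule has_derivative_bounded_linear)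
  have "((\<lambda>t. x + t *\<^sub>R axis i 1) has_derivative (\<lambda>h. h *\<^sub>R axis i 1)) (at t)"
    by (auto intro!: derivative_eq_intros)
  from diff_chain_at[OF this D]
  have "((\<lambda>t. \<psi> (x + t *\<^sub>R axis i 1)) has_derivative (\<lambda>h. ?D (h *\<^sub>R axis i 1))) (at t)"
    by (simp add: comp_def)
  then show ?thesis
    by (simp add: has_field_derivative_def partial_deriv_def scaleR mult.commute[of _ "?D _"] fun_eq_iff)
qed

text \<open>By translation invariance the difference quotients in direction \<open>i\<close> have integral zero.\<close>

lemma integral_partial_deriv_eq_0:
  assumes \<psi>: "C_k 1 \<psi>" and K: "compact K" "\<And>x. x \<notin> K \<Longrightarrow> \<psi> x = 0"
  shows "(LINT x|lborel. partial_deriv i \<psi> x) = 0"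
proof -
  let ?e = "axis i 1"
  define h where "h m = 1 / real (Suc m)" for m
  define q where "q m x = (\<psi> (x + h m *\<^sub>R ?e) - \<psi> x) / h m" for m x
  \<comment> \<open>All step sizes are at most 1, so this compact set contains the supports of all
    difference quotients at once.\<close>
  define K' where "K' = {x - y | x y. x \<in> K \<and> y \<in> cball 0 (1::real)}"
  have h: "0 < h m" "h m \<le> 1" for m by (auto simp: h_def)
  have cont: "continuous_on UNIV \<psi>" "continuous_on UNIV (partial_deriv i \<psi>)"
    using \<psi> C_k_imp_continuous continuous_partial_deriv by blast+
  have [measurable]: "\<psi> \<in> borel_measurable borel" "partial_deriv i \<psi> \<in> borel_measurable borel"
    using cont by (auto intro: borel_measurable_continuous_onI)
  have K': "compact K'" unfolding K'_def by (rule compact_differences) (use K in auto)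
  have inK': "k - y \<in> K'" if "k \<in> K" "norm y \<le> 1" for k y
    using that by (auto simp: K'_def)
  have "compact (partial_deriv i \<psi> ` K)"
    using cont K by (blast intro: compact_continuous_image continuous_on_subset)
  then obtain B where "\<forall>x\<in>K. \<bar>partial_deriv i \<psi> x\<bar> \<le> B"
    by (auto dest!: compact_imp_bounded simp: bounded_iff)
  \<comment> \<open>If K is empty, \<open>B\<close> can be negative; the absolute value covers that
    case and the points outside K.\<close>
  then have B: "\<bar>partial_deriv i \<psi> x\<bar> \<le> \<bar>B\<bar>" for x
    using partial_deriv_outside[of K \<psi>, OF compact_imp_closed[OF K(1)] K(2), of x i] by (cases "x \<in> K") force+
  have "\<psi> x = indicator K x *\<^sub>R \<psi> x" for x using K(2) by (cases "x \<in> K") auto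
  then have "\<psi> = (\<lambda>x. indicator K x *\<^sub>R \<psi> x)" by blast
  then have int: "integrable lborel \<psi>"
    using borel_integrable_compact[OF K(1), of \<psi>] cont by (metis continuous_on_subset subset_UNIV)
  have shift: "integrable lborel (\<lambda>x. \<psi> (c + x))" "(LINT x|lborel. \<psi> (c + x)) = (LINT x|lborel. \<psi> x)" for c
    using integrable_distr_eq[of "(+) c" lborel borel \<psi>] integral_distr[of "(+) c" lborel borel \<psi>] int
    by (simp_all add: lborel_distr_plus)
  have q0: "(LINT x|lborel. q m x) = 0" for m
    using shift[of "h m *\<^sub>R ?e"] int by (simp add: q_def add.commute)
  have "(\<lambda>m. LINT x|lborel. q m x) \<longlonglongrightarrow> (LINT x|lborel. partial_deriv i \<psi> x)"
  proof (rule integral_dominated_convergence[where w = "\<lambda>x. indicator K' x *\<^sub>R \<bar>B\<bar>"])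
    show "(\<lambda>x. q m x) \<in> borel_measurable lborel" for m unfolding q_def by measurable
    show "integrable lborel (\<lambda>x. indicator K' x *\<^sub>R \<bar>B\<bar>)"
      by (rule borel_integrable_compact[OF K' continuous_on_const])
    have "(\<lambda>m. q m x) \<longlonglongrightarrow> partial_deriv i \<psi> x" for x
    proof -
      have "((\<lambda>t. (\<psi> (x + t *\<^sub>R ?e) - \<psi> x) / t) \<longlongrightarrow> partial_deriv i \<psi> x) (at 0)"
        using DERIV_along_axis[OF \<psi>, of x i 0] by (simp add: DERIV_def)
      moreover have "filterlim h (at 0) sequentially"
        unfolding h_def using LIMSEQ_Suc[OF lim_1_over_n] by (auto simp: filterlim_at)
      ultimately show ?thesis unfolding q_def by (rule filterlim_compose)
    qed
    then show "AE x in lborel. (\<lambda>m. q m x) \<longlonglongrightarrow> partial_deriv i \<psi> x" by simp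
    have "norm (q m x) \<le> indicator K' x *\<^sub>R \<bar>B\<bar>" for m x
    proof (cases "x \<in> K'")
      case True
      \<comment> \<open>The mean value theorem turns the quotient into a value of the derivative,
        which gives the dominating constant.\<close>
      obtain t where t: "\<psi> (x + h m *\<^sub>R ?e) - \<psi> (x + 0 *\<^sub>R ?e) = (h m - 0) * partial_deriv i \<psi> (x + t *\<^sub>R ?e)"
        using MVT2[of 0 "h m" "\<lambda>t. \<psi> (x + t *\<^sub>R ?e)" "\<lambda>t. partial_deriv i \<psi> (x + t *\<^sub>R ?e)"]
          DERIV_along_axis[OF \<psi>] h by blast
      then have "q m x = partial_deriv i \<psi> (x + t *\<^sub>R ?e)"
        using h(1)[of m] by (simp add: q_def)
      then show ?thesis using B True by simp
    next
      case False
      have "x \<notin> K" using False inK'[of x 0] by auto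
      moreover have "x + h m *\<^sub>R ?e \<notin> K"
        using False h[of m] inK'[of "x + h m *\<^sub>R ?e" "h m *\<^sub>R ?e"] by auto
      ultimately show ?thesis using False K(2) by (simp add: q_def)
    qed
    then show "AE x in lborel. norm (q m x) \<le> indicator K' x *\<^sub>R \<bar>B\<bar>" for m by simp
  qed simp
  then show ?thesis unfolding q0 by (simp add: LIMSEQ_const_iff)
qed

context bounded_open_set
begin

lemma integral_partial_deriv_test_function:
  assumes "\<phi> \<in> test_functions \<Omega>"
  shows "(LINT x|lebesgue_on \<Omega>. partial_deriv i \<phi> x) = 0"
proof -
  obtain K where K: "\<And>k. C_k k \<phi>" "compact K" "K \<subseteq> \<Omega>" "\<And>x. x \<notin> K \<Longrightarrow> \<phi> x = 0"
    using assms by (metis test_functionE)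
  have "partial_deriv i \<phi> \<in> borel_measurable borel"
    using K(1) by (intro borel_measurable_continuous_onI continuous_partial_deriv)
  have "(\<lambda>x. if x \<in> \<Omega> then partial_deriv i \<phi> x else 0) = partial_deriv i \<phi>"
    using partial_deriv_outside[of K \<phi>, OF compact_imp_closed[OF K(2)] K(4)] K(3) by (auto simp: fun_eq_iff)
  then have "(LINT x|lebesgue_on \<Omega>. partial_deriv i \<phi> x) = (LINT x|lebesgue. partial_deriv i \<phi> x)"
    using Lebesgue_Measure.integral_restrict_UNIV[OF \<Omega>_sets(1), of "partial_deriv i \<phi>"] by simp
  also have "\<dots> = (LINT x|lborel. partial_deriv i \<phi> x)"
    by (rule integral_completion) (simp add: \<open>partial_deriv i \<phi> \<in> _\<close>)
  also have "\<dots> = 0" using K by (intro integral_partial_deriv_eq_0[of _ K])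
  finally show ?thesis .
qed

lemma test_function_L2:
  assumes "\<phi> \<in> test_functions \<Omega>"
  shows "\<phi> \<in> L2 \<Omega>" "partial_deriv i \<phi> \<in> L2 \<Omega>"
  using assms by (auto intro!: continuous_in_L2 C_k_imp_continuous[OF test_function_C_k]
    continuous_partial_deriv test_function_C_k simp del: One_nat_def)

text \<open>Integration by parts is the product rule together with the vanishing integral of a
  derivative of the test function \<phi> \<psi>.\<close>

lemma weak_gradient_test_function:
  assumes \<phi>: "\<phi> \<in> test_functions \<Omega>"
  shows "weak_gradient \<Omega> \<phi> (\<lambda>x. \<chi> i. partial_deriv i \<phi> x)"
  unfolding weak_gradient_def
proof (intro conjI ballI allI)
  show "\<phi> \<in> L2 \<Omega>" by (rule test_function_L2[OF \<phi>])
  show "(\<lambda>x. \<chi> i. partial_deriv i \<phi> x) \<in> L2 \<Omega>"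
    by (intro continuous_in_L2 continuous_on_vec_lambda continuous_partial_deriv test_function_C_k[OF \<phi>])
  fix \<psi> i assume \<psi>: "\<psi> \<in> test_functions \<Omega>"
  have "(LINT x|lebesgue_on \<Omega>. \<phi> x * partial_deriv i \<psi> x) + (LINT x|lebesgue_on \<Omega>. partial_deriv i \<phi> x * \<psi> x)
      = (LINT x|lebesgue_on \<Omega>. \<phi> x * partial_deriv i \<psi> x + partial_deriv i \<phi> x * \<psi> x)"
    by (intro Bochner_Integration.integral_add[symmetric] L2_mult_integrable test_function_L2 \<phi> \<psi>)
  also have "\<dots> = (LINT x|lebesgue_on \<Omega>. partial_deriv i (\<lambda>x. \<phi> x * \<psi> x) x)"
    using test_function_C_k[OF \<phi>] test_function_C_k[OF \<psi>] by (simp only: partial_deriv_mult)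
  also have "\<dots> = 0"
    by (intro integral_partial_deriv_test_function test_functions_mult test_function_C_k[OF \<phi>] \<psi>)
  finally show "(LINT x|lebesgue_on \<Omega>. \<phi> x * partial_deriv i \<psi> x)
      = - (LINT x|lebesgue_on \<Omega>. (\<chi> i. partial_deriv i \<phi> x) $ i * \<psi> x)" by simp
qed

lemma test_function_H1: "\<phi> \<in> test_functions \<Omega> \<Longrightarrow> \<phi> \<in> H1 \<Omega>"
  using weak_gradient_test_function by (auto simp: H1_def)

text \<open>Based on \<open>\<integral> \<partial>\<^sub>i(x\<^sub>i \<phi>\<^sup>2) = 0\<close>.\<close>

lemma poincare_test_function:
  assumes \<phi>: "\<phi> \<in> test_functions \<Omega>" and R: "\<And>x. x \<in> \<Omega> \<Longrightarrow> norm x \<le> R"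
  shows "(L2norm \<Omega> \<phi>)\<^sup>2 \<le> 4 * R\<^sup>2 * (L2norm \<Omega> (wgrad \<Omega> \<phi>))\<^sup>2"
proof -
  let ?M = "lebesgue_on \<Omega>"
  \<comment> \<open>One coordinate direction suffices; index types are inhabited, so any
    \<open>i\<close> will do.\<close>
  obtain i :: 'd where True by simp
  note C = test_function_C_k[OF \<phi>] C_k_component
  note L2 = test_function_L2[OF \<phi>]
  have x\<phi>: "(\<lambda>x. x $ i * \<phi> x) \<in> test_functions \<Omega>" by (intro test_functions_mult C \<phi>)
  have "(\<lambda>x. \<phi> x * (x $ i * \<phi> x)) \<in> test_functions \<Omega>" by (intro test_functions_mult x\<phi> C)
  from integral_partial_deriv_test_function[OF this, of i]
  have "0 = (LINT x|?M. (\<phi> x)\<^sup>2 + 2 * ((x $ i * \<phi> x) * partial_deriv i \<phi> x))"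
    by (simp add: partial_deriv_mult[OF C(1)] C_k_mult C partial_deriv_component algebra_simps
        power2_eq_square del: One_nat_def C_k.simps)
  also have "\<dots> = (LINT x|?M. (\<phi> x)\<^sup>2) + 2 * (LINT x|?M. (x $ i * \<phi> x) * partial_deriv i \<phi> x)"
    using L2_mult_integrable[OF test_function_L2(1)[OF x\<phi>] L2(2), of i] L2D(2)[OF L2(1)] by simp
  finally have "(L2norm \<Omega> \<phi>)\<^sup>2 = - 2 * (LINT x|?M. (x $ i * \<phi> x) * partial_deriv i \<phi> x)"
    by (simp add: L2norm_sq)
  also have "\<dots> = (LINT x|?M. - 2 * ((x $ i * \<phi> x) * partial_deriv i \<phi> x))" by simp
  \<comment> \<open>Young's inequality with weight 1/2, so that half of the left side can be
    absorbed; doubling 2 R^2 then gives the constant 4 R^2.\<close>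
  also have "\<dots> \<le> (LINT x|?M. 1 / 2 * (\<phi> x)\<^sup>2 + 2 * R\<^sup>2 * (norm (\<chi> i. partial_deriv i \<phi> x))\<^sup>2)"
  proof (rule integral_mono_AE)
    show "integrable ?M (\<lambda>x. - 2 * ((x $ i * \<phi> x) * partial_deriv i \<phi> x))"
      using L2_mult_integrable[OF test_function_L2(1)[OF x\<phi>] L2(2), of i] by simp
    show "integrable ?M (\<lambda>x. 1 / 2 * (\<phi> x)\<^sup>2 + 2 * R\<^sup>2 * (norm (\<chi> i. partial_deriv i \<phi> x))\<^sup>2)"
      using L2D(2)[OF L2(1)] weak_gradient_test_function[OF \<phi>] by (auto simp: weak_gradient_def dest!: L2D(2))
    have "- 2 * ((x $ i * \<phi> x) * partial_deriv i \<phi> x)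
        \<le> 1 / 2 * (\<phi> x)\<^sup>2 + 2 * R\<^sup>2 * (norm (\<chi> i. partial_deriv i \<phi> x))\<^sup>2" if "x \<in> \<Omega>" for x
    proof -
      let ?g = "\<chi> i. partial_deriv i \<phi> x"
      have "\<bar>x $ i\<bar> \<le> R" using R[OF that] component_le_norm_cart[of x i] by linarith
      moreover have "\<bar>partial_deriv i \<phi> x\<bar> \<le> norm ?g" using component_le_norm_cart[of ?g i] by simp
      ultimately have "\<bar>x $ i * partial_deriv i \<phi> x\<bar> \<le> R * norm ?g"
        unfolding abs_mult by (intro mult_mono) auto
      then have "(x $ i * partial_deriv i \<phi> x)\<^sup>2 \<le> R\<^sup>2 * (norm ?g)\<^sup>2"
        by (metis abs_ge_zero power2_abs power_mono power_mult_distrib)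
      moreover have "0 \<le> (\<phi> x + 2 * (x $ i * partial_deriv i \<phi> x))\<^sup>2" by simp
      ultimately show ?thesis by (simp add: power2_eq_square algebra_simps)
    qed
    then show "AE x in ?M. - 2 * ((x $ i * \<phi> x) * partial_deriv i \<phi> x)
        \<le> 1 / 2 * (\<phi> x)\<^sup>2 + 2 * R\<^sup>2 * (norm (\<chi> i. partial_deriv i \<phi> x))\<^sup>2"
      by (intro AE_I2) (simp add: space_restrict_space)
  qed
  also have "\<dots> = 1 / 2 * (L2norm \<Omega> \<phi>)\<^sup>2 + 2 * R\<^sup>2 * (L2norm \<Omega> (\<lambda>x. \<chi> i. partial_deriv i \<phi> x))\<^sup>2"
    using L2D(2)[OF L2(1)] weak_gradient_test_function[OF \<phi>]
    by (auto simp: weak_gradient_def L2norm_sq dest!: L2D(2))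
  \<comment> \<open>The classical gradient is one weak gradient and the chosen one is another; they
    agree almost everywhere.\<close>
  also have "(L2norm \<Omega> (\<lambda>x. \<chi> i. partial_deriv i \<phi> x))\<^sup>2 = (L2norm \<Omega> (wgrad \<Omega> \<phi>))\<^sup>2"
    unfolding L2norm_sq
  proof (rule integral_cong_AE)
    have *: "(\<lambda>x. \<chi> i. partial_deriv i \<phi> x) \<in> borel_measurable ?M" "wgrad \<Omega> \<phi> \<in> borel_measurable ?M"
      using weak_gradient_test_function[OF \<phi>] H1_in_L2(2)[OF test_function_H1[OF \<phi>]]
      by (auto simp: weak_gradient_def L2_def)
    show "(\<lambda>x. (norm (\<chi> i. partial_deriv i \<phi> x))\<^sup>2) \<in> borel_measurable ?M"
      "(\<lambda>x. (norm (wgrad \<Omega> \<phi> x))\<^sup>2) \<in> borel_measurable ?M" using * by simp_all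
    have "AE x in ?M. (\<chi> i. partial_deriv i \<phi> x) = wgrad \<Omega> \<phi> x"
      by (intro weak_gradient_unique[OF weak_gradient_test_function[OF \<phi>]] wgrad_weak_gradient test_function_H1 \<phi>)
    then show "AE x in ?M. (norm (\<chi> i. partial_deriv i \<phi> x))\<^sup>2 = (norm (wgrad \<Omega> \<phi> x))\<^sup>2"
      by eventually_elim simp
  qed
  finally show ?thesis by simp
qed

text \<open>The function \<open>r\<close> is a separate parameter, equal to the sum only almost
  everywhere, so that the bound applies to \<open>wgrad\<close> of a sum or difference.\<close>

lemma L2norm_sq_add_le:
  fixes v w :: "real^'d \<Rightarrow> 'b::euclidean_space"
  assumes "v \<in> L2 \<Omega>" "w \<in> L2 \<Omega>" "r \<in> borel_measurable (lebesgue_on \<Omega>)"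
    "AE x in lebesgue_on \<Omega>. r x = v x + w x"
  shows "(L2norm \<Omega> r)\<^sup>2 \<le> 2 * (L2norm \<Omega> v)\<^sup>2 + 2 * (L2norm \<Omega> w)\<^sup>2"
proof -
  have "(L2norm \<Omega> r)\<^sup>2 = (LINT x|lebesgue_on \<Omega>. (norm (v x + w x))\<^sup>2)"
    unfolding L2norm_sq
    by (rule integral_cong_AE) (use assms L2D(1)[OF assms(1)] L2D(1)[OF assms(2)] in auto)
  also have "\<dots> \<le> (LINT x|lebesgue_on \<Omega>. 2 * (norm (v x))\<^sup>2 + 2 * (norm (w x))\<^sup>2)"
    using L2D(2)[OF assms(1)] L2D(2)[OF assms(2)] L2D(2)[OF L2_add[OF assms(1,2)]]
    by (intro integral_mono norm_add_sq_le) auto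
  also have "\<dots> = 2 * (L2norm \<Omega> v)\<^sup>2 + 2 * (L2norm \<Omega> w)\<^sup>2"
    using L2D(2)[OF assms(1)] L2D(2)[OF assms(2)] by (simp add: L2norm_sq)
  finally show ?thesis .
qed

lemma H1norm_sq: "(H1norm \<Omega> v)\<^sup>2 = (L2norm \<Omega> v)\<^sup>2 + (L2norm \<Omega> (wgrad \<Omega> v))\<^sup>2"
  by (simp add: H1norm_def)

lemma H1norm_nonneg: "0 \<le> H1norm \<Omega> v"
  by (simp add: H1norm_def)

lemma H10_in_H1: "v \<in> H10 \<Omega> \<Longrightarrow> v \<in> H1 \<Omega>"
  by (simp add: H10_def)

text \<open>Differences of the approximating test functions approximate the difference. The estimate
  runs on squared norms, so no Minkowski inequality for \<open>H1norm\<close> enters.\<close>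

lemma H10_diff:
  assumes "v \<in> H10 \<Omega>" "w \<in> H10 \<Omega>"
  shows "(\<lambda>x. v x - w x) \<in> H10 \<Omega>"
proof -
  obtain \<phi> \<psi> where \<phi>: "\<And>m::nat. \<phi> m \<in> test_functions \<Omega>" "(\<lambda>m. H1norm \<Omega> (\<lambda>x. v x - \<phi> m x)) \<longlonglongrightarrow> 0"
    and \<psi>: "\<And>m::nat. \<psi> m \<in> test_functions \<Omega>" "(\<lambda>m. H1norm \<Omega> (\<lambda>x. w x - \<psi> m x)) \<longlonglongrightarrow> 0"
    using assms unfolding H10_def by blast
  note H1 = H10_in_H1[OF assms(1)] H10_in_H1[OF assms(2)] test_function_H1[OF \<phi>(1)] test_function_H1[OF \<psi>(1)]
  let ?n = "\<lambda>m. (H1norm \<Omega> (\<lambda>x. (v x - w x) - (\<phi> m x - \<psi> m x)))\<^sup>2"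
  let ?b = "\<lambda>m. 2 * (H1norm \<Omega> (\<lambda>x. v x - \<phi> m x))\<^sup>2 + 2 * (H1norm \<Omega> (\<lambda>x. w x - \<psi> m x))\<^sup>2"
  have le: "?n m \<le> ?b m" for m
  proof -
    let ?a = "\<lambda>x. v x - \<phi> m x" and ?c = "\<lambda>x. w x - \<psi> m x"
    have h: "?a \<in> H1 \<Omega>" "?c \<in> H1 \<Omega>" by (intro H1_diff H1)+
    have eq: "(\<lambda>x. (v x - w x) - (\<phi> m x - \<psi> m x)) = (\<lambda>x. ?a x - ?c x)" by auto
    have "(L2norm \<Omega> (\<lambda>x. ?a x - ?c x))\<^sup>2 \<le> 2 * (L2norm \<Omega> ?a)\<^sup>2 + 2 * (L2norm \<Omega> (\<lambda>x. - ?c x))\<^sup>2"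
      using h H1_in_L2(1) L2D(1)[OF L2_diff[OF H1_in_L2(1)[OF h(1)] H1_in_L2(1)[OF h(2)]]]
        L2_bounded_linear[OF bounded_linear_minus[OF bounded_linear_ident] H1_in_L2(1)[OF h(2)]]
      by (intro L2norm_sq_add_le) auto
    moreover have "(L2norm \<Omega> (wgrad \<Omega> (\<lambda>x. ?a x - ?c x)))\<^sup>2
        \<le> 2 * (L2norm \<Omega> (wgrad \<Omega> ?a))\<^sup>2 + 2 * (L2norm \<Omega> (\<lambda>x. - wgrad \<Omega> ?c x))\<^sup>2"
      using L2D(1)[OF H1_in_L2(2)[OF H1_diff[OF h]]] H1_in_L2(2)[OF h(1)] wgrad_diff[OF h]
        L2_bounded_linear[OF bounded_linear_minus[OF bounded_linear_ident] H1_in_L2(2)[OF h(2)]]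
      by (intro L2norm_sq_add_le) auto
    moreover have "L2norm \<Omega> (\<lambda>x. - ?c x) = L2norm \<Omega> ?c"
      "L2norm \<Omega> (\<lambda>x. - wgrad \<Omega> ?c x) = L2norm \<Omega> (wgrad \<Omega> ?c)"
      unfolding L2norm_def norm_minus_cancel by (rule refl)+
    ultimately show ?thesis unfolding eq H1norm_sq by simp
  qed
  have "?b \<longlonglongrightarrow> 2 * 0\<^sup>2 + 2 * 0\<^sup>2" by (intro tendsto_intros \<phi> \<psi>)
  then have "?b \<longlonglongrightarrow> 0" by simp
  then have "?n \<longlonglongrightarrow> 0"
    by (rule tendsto_sandwich[OF always_eventually[rule_format] always_eventually[rule_format] tendsto_const, rotated -1])
      (rule zero_le_power2, rule le)
  then have "(\<lambda>m. sqrt (?n m)) \<longlonglongrightarrow> sqrt 0" by (intro tendsto_real_sqrt)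
  then have "(\<lambda>m. H1norm \<Omega> (\<lambda>x. (v x - w x) - (\<phi> m x - \<psi> m x))) \<longlonglongrightarrow> 0"
    by (simp add: abs_of_nonneg[OF H1norm_nonneg])
  then show ?thesis
    unfolding H10_def using H1_diff[OF H1(1,2)] test_functions_diff[OF \<phi>(1) \<psi>(1)]
    by (auto intro!: exI[of _ "\<lambda>m x. \<phi> m x - \<psi> m x"])
qed

text \<open>Density argument: splitting the function and then the gradient through an approximating
  test function costs a factor 2 each time, which turns 4 R^2 into 16 R^2, and the remaining terms
  vanish in the limit.\<close>

lemma poincare:
  obtains c where "0 < c" "\<And>v. v \<in> H10 \<Omega> \<Longrightarrow> (L2norm \<Omega> v)\<^sup>2 \<le> c * (L2norm \<Omega> (wgrad \<Omega> v))\<^sup>2"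
proof -
  obtain R where R: "0 < R" "\<And>x. x \<in> \<Omega> \<Longrightarrow> norm x \<le> R"
    using bounded_\<Omega> by (auto simp: bounded_pos)
  have "(L2norm \<Omega> v)\<^sup>2 \<le> 16 * R\<^sup>2 * (L2norm \<Omega> (wgrad \<Omega> v))\<^sup>2" if v: "v \<in> H10 \<Omega>" for v
  proof -
    obtain \<phi> where \<phi>: "\<And>m::nat. \<phi> m \<in> test_functions \<Omega>" "(\<lambda>m. H1norm \<Omega> (\<lambda>x. v x - \<phi> m x)) \<longlonglongrightarrow> 0"
      using v unfolding H10_def by blast
    let ?N = "\<lambda>m. (H1norm \<Omega> (\<lambda>x. v x - \<phi> m x))\<^sup>2"
    have le: "(L2norm \<Omega> v)\<^sup>2 \<le> (2 + 16 * R\<^sup>2) * ?N m + 16 * R\<^sup>2 * (L2norm \<Omega> (wgrad \<Omega> v))\<^sup>2" for m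
    proof -
      let ?d = "\<lambda>x. v x - \<phi> m x"
      have h: "v \<in> H1 \<Omega>" "\<phi> m \<in> H1 \<Omega>" "?d \<in> H1 \<Omega>"
        using H10_in_H1[OF v] test_function_H1[OF \<phi>(1)] H1_diff by blast+
      have "(L2norm \<Omega> v)\<^sup>2 \<le> 2 * (L2norm \<Omega> ?d)\<^sup>2 + 2 * (L2norm \<Omega> (\<phi> m))\<^sup>2"
        using H1_in_L2(1)[OF h(1)] H1_in_L2(1)[OF h(2)] H1_in_L2(1)[OF h(3)] L2D
        by (intro L2norm_sq_add_le) auto
      also have "(L2norm \<Omega> (\<phi> m))\<^sup>2 \<le> 4 * R\<^sup>2 * (L2norm \<Omega> (wgrad \<Omega> (\<phi> m)))\<^sup>2"
        by (rule poincare_test_function[OF \<phi>(1) R(2)])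
      also have "(L2norm \<Omega> (wgrad \<Omega> (\<phi> m)))\<^sup>2
          \<le> 2 * (L2norm \<Omega> (wgrad \<Omega> v))\<^sup>2 + 2 * (L2norm \<Omega> (\<lambda>x. - wgrad \<Omega> ?d x))\<^sup>2"
        using L2D(1)[OF H1_in_L2(2)[OF h(2)]] H1_in_L2(2)[OF h(1)] wgrad_diff[OF h(1,2)]
          L2_bounded_linear[OF bounded_linear_minus[OF bounded_linear_ident] H1_in_L2(2)[OF h(3)]]
        by (intro L2norm_sq_add_le) auto
      also have "L2norm \<Omega> (\<lambda>x. - wgrad \<Omega> ?d x) = L2norm \<Omega> (wgrad \<Omega> ?d)"
        unfolding L2norm_def norm_minus_cancel by (rule refl)
      finally have *: "(L2norm \<Omega> v)\<^sup>2 \<le> 2 * (L2norm \<Omega> ?d)\<^sup>2 + 2 * (4 * R\<^sup>2 *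
          (2 * (L2norm \<Omega> (wgrad \<Omega> v))\<^sup>2 + 2 * (L2norm \<Omega> (wgrad \<Omega> ?d))\<^sup>2))"
        by (simp add: mult_left_mono)
      have "0 \<le> R\<^sup>2 * (L2norm \<Omega> ?d)\<^sup>2" "0 \<le> (L2norm \<Omega> (wgrad \<Omega> ?d))\<^sup>2" by simp_all
      with * show ?thesis unfolding H1norm_sq distrib_left distrib_right by linarith
    qed
    have "(\<lambda>m. (2 + 16 * R\<^sup>2) * ?N m + 16 * R\<^sup>2 * (L2norm \<Omega> (wgrad \<Omega> v))\<^sup>2)
        \<longlonglongrightarrow> (2 + 16 * R\<^sup>2) * 0\<^sup>2 + 16 * R\<^sup>2 * (L2norm \<Omega> (wgrad \<Omega> v))\<^sup>2"
      by (intro tendsto_intros \<phi>)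
    from tendsto_le[OF _ this tendsto_const[of "(L2norm \<Omega> v)\<^sup>2"]] le
    show ?thesis by auto
  qed
  with R(1) show thesis by (intro that[of "16 * R\<^sup>2"]) auto
qed

end

section \<open>Ellipticity and the energy norm\<close>

lemma polyhedral_domain_open_bounded:
  assumes "polyhedral_domain \<Omega>"
  shows "open \<Omega>" "bounded \<Omega>"
proof -
  obtain P where P: "finite P" "\<And>p. p \<in> P \<Longrightarrow> polytope p" "\<Omega> = interior (\<Union>P)"
    using assms by (auto simp: polyhedral_domain_def)
  then have "bounded (\<Union>P)" by (auto simp: polytope_imp_bounded)
  with P(3) show "open \<Omega>" "bounded \<Omega>"
    using bounded_subset interior_subset by auto
qed

section \<open>Eigenvalues of symmetric matrices\<close>

lemma symmetric_dot_commute: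
  fixes M :: "real^'d^'d"
  assumes "transpose M = M"
  shows "(M *v v) \<bullet> w = (M *v w) \<bullet> v"
  using dot_lmul_matrix[of v M w] transpose_matrix_vector[of M v] assms by (simp add: inner_commute)

text \<open>\<open>lambda_min\<close> is a \<open>Min\<close>, which is meaningful only for a finite
  nonempty set. Eigenvectors of distinct eigenvalues are orthogonal, hence independent, hence finite
  in number.\<close>

lemma finite_eigenvals:
  fixes M :: "real^'d^'d"
  assumes "transpose M = M"
  shows "finite (eigenvals M)"
proof -
  have "\<forall>l\<in>eigenvals M. \<exists>v. v \<noteq> 0 \<and> M *v v = l *\<^sub>R v"
    by (simp add: eigenvals_def)
  then obtain v where v: "\<And>l. l \<in> eigenvals M \<Longrightarrow> v l \<noteq> 0 \<and> M *v v l = l *\<^sub>R v l"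
    using bchoice by metis
  have orth: "v l \<bullet> v l' = 0" if "l \<in> eigenvals M" "l' \<in> eigenvals M" "l \<noteq> l'" for l l'
  proof -
    have "l * (v l \<bullet> v l') = l' * (v l \<bullet> v l')"
      using symmetric_dot_commute[OF assms, of "v l" "v l'"] v that by (simp add: inner_commute)
    with that(3) show ?thesis by simp
  qed
  \<comment> \<open>A vector shared by two eigenvalues would be orthogonal to itself.\<close>
  then have inj: "inj_on v (eigenvals M)"
    using v by (metis inj_onI inner_eq_zero_iff)
  have "pairwise orthogonal (v ` eigenvals M)"
    using orth by (auto simp: pairwise_def orthogonal_def)
  then have "independent (v ` eigenvals M)"
    using v by (intro pairwise_orthogonal_independent) force+
  then show ?thesis
    using finite_imageD[OF independent_imp_finite inj] by blast
qed

text \<open>The minimum of the Rayleigh quotient over the unit sphere is an eigenvalue: the shifted form is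
  nonnegative and vanishes at a minimiser, which therefore lies in its kernel.\<close>

lemma rayleigh_minimum:
  fixes M :: "real^'d^'d"
  assumes sym: "transpose M = M"
  obtains l where "l \<in> eigenvals M" "\<And>v. l * (norm v)\<^sup>2 \<le> (M *v v) \<bullet> v"
proof -
  let ?S = "sphere 0 1 :: (real^'d) set"
  have "axis undefined 1 \<in> ?S" by simp
  then have "?S \<noteq> {}" by blast
  moreover have "continuous_on ?S (\<lambda>v. (M *v v) \<bullet> v)"
    by (intro continuous_intros matrix_vector_mult_linear_continuous_on)
  ultimately obtain v0 where v0: "v0 \<in> ?S" "\<And>v. v \<in> ?S \<Longrightarrow> (M *v v0) \<bullet> v0 \<le> (M *v v) \<bullet> v"
    using continuous_attains_inf[OF compact_sphere] by blast
  define l where "l = (M *v v0) \<bullet> v0"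
  have ge: "l * (norm v)\<^sup>2 \<le> (M *v v) \<bullet> v" for v
  proof (cases "v = 0")
    case False
    then have "l \<le> (M *v ((1 / norm v) *\<^sub>R v)) \<bullet> ((1 / norm v) *\<^sub>R v)"
      unfolding l_def by (intro v0) simp
    also have "\<dots> = ((M *v v) \<bullet> v) / (norm v)\<^sup>2"
      by (simp add: matrix_vector_mult_scaleR power2_eq_square)
    finally show ?thesis using False by (simp add: field_simps)
  qed simp
  \<comment> \<open>The residual of the eigenvalue equation. Moving the minimiser in this direction
    gives first-order term 2 t |w|^2 in the shifted form, which is incompatible with nonnegativity
    for small negative t unless w = 0.\<close>
  define w where "w = M *v v0 - l *\<^sub>R v0"
  define q where "q = (M *v w) \<bullet> w - l * (w \<bullet> w)"
  have "0 \<le> q" using ge[of w] by (simp add: q_def power2_norm_eq_inner)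
  have nonneg: "0 \<le> 2 * t * (w \<bullet> w) + t\<^sup>2 * q" for t
  proof -
    have form: "(M *v (v0 + t *\<^sub>R w)) \<bullet> (v0 + t *\<^sub>R w)
        = l + 2 * t * ((M *v v0) \<bullet> w) + t\<^sup>2 * ((M *v w) \<bullet> w)"
      using symmetric_dot_commute[OF sym, of w v0]
      by (simp add: matrix_vector_right_distrib matrix_vector_mult_scaleR inner_add_left
          inner_add_right l_def power2_eq_square algebra_simps)
    have "v0 \<bullet> v0 = 1" using v0(1) by (simp add: norm_eq_1)
    then have nrm: "(norm (v0 + t *\<^sub>R w))\<^sup>2 = 1 + 2 * t * (v0 \<bullet> w) + t\<^sup>2 * (w \<bullet> w)"
      unfolding power2_norm_eq_inner
      by (simp add: inner_add_left inner_add_right power2_eq_square inner_commute[of w v0] algebra_simps)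
    have "l + 2 * t * (l * (v0 \<bullet> w)) + t\<^sup>2 * (l * (w \<bullet> w))
        \<le> l + 2 * t * ((M *v v0) \<bullet> w) + t\<^sup>2 * ((M *v w) \<bullet> w)"
      using ge[of "v0 + t *\<^sub>R w"] unfolding form nrm by (simp add: distrib_left mult.left_commute)
    moreover have "2 * t * (w \<bullet> w) = 2 * t * ((M *v v0) \<bullet> w) - 2 * t * (l * (v0 \<bullet> w))"
      unfolding right_diff_distrib[symmetric] by (simp add: w_def inner_diff_left)
    ultimately show ?thesis unfolding q_def right_diff_distrib by linarith
  qed
  \<comment> \<open>At t = -r the quadratic equals -r^2 (q + 2), which forces r = 0. Dividing by q +
    1 instead of q covers q = 0 as well.\<close>
  define r where "r = (w \<bullet> w) / (q + 1)"
  have ww: "w \<bullet> w = r * (q + 1)" using \<open>0 \<le> q\<close> by (simp add: r_def)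
  have "r * r * (q + 2) \<le> 0"
    using nonneg[of "- r"] unfolding ww by (simp add: power2_eq_square algebra_simps)
  then have "r = 0"
    using \<open>0 \<le> q\<close> by (auto simp: mult_le_0_iff)
  with ww have "w \<bullet> w = 0" by simp
  then have "M *v v0 = l *\<^sub>R v0" by (simp add: w_def)
  moreover have "v0 \<noteq> 0" using v0(1) by auto
  ultimately have "l \<in> eigenvals M" by (auto simp: eigenvals_def)
  with ge show thesis by (rule that[rotated])
qed

text \<open>The Rayleigh minimum at x is an eigenvalue, hence at least
  \<open>lambda_min (A x)\<close>, which is at least the infimum \<mu>0.\<close>

lemma elliptic_coefficient_lower_bound:
  assumes A: "elliptic_coefficient \<Omega> A \<mu>0 \<mu>1" and x: "x \<in> \<Omega>"
  shows "\<mu>0 * (norm v)\<^sup>2 \<le> (A x *v v) \<bullet> v"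
proof -
  have sym: "transpose (A y) = A y" and pos: "v \<noteq> 0 \<Longrightarrow> 0 < (A y *v v) \<bullet> v" if "y \<in> \<Omega>" for y v
    using A that by (auto simp: elliptic_coefficient_def)
  have min: "lambda_min (A y) \<in> eigenvals (A y)" if "y \<in> \<Omega>" for y
  proof -
    have "eigenvals (A y) \<noteq> {}" using rayleigh_minimum[OF sym[OF that]] by blast
    then show ?thesis
      unfolding lambda_min_def using finite_eigenvals[OF sym[OF that]] by (intro Min_in)
  qed
  have "0 \<le> l" if y: "y \<in> \<Omega>" and l: "l \<in> eigenvals (A y)" for y l
  proof -
    obtain w where w: "w \<noteq> 0" "A y *v w = l *\<^sub>R w" using l unfolding eigenvals_def by blast
    with pos[OF y w(1)] show ?thesis using inner_ge_zero[of w] by (auto simp: zero_less_mult_iff)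
  qed
  \<comment> \<open>A real \<open>INF\<close> is a lower bound only for a family bounded below;
    positive definiteness supplies the bound 0.\<close>
  with min have "bdd_below ((\<lambda>y. lambda_min (A y)) ` \<Omega>)"
    by (intro bdd_belowI2[of _ 0]) blast
  then have "\<mu>0 \<le> lambda_min (A x)"
    using A cINF_lower[of "\<lambda>y. lambda_min (A y)" \<Omega> x] x by (simp add: elliptic_coefficient_def)
  moreover obtain l where l: "l \<in> eigenvals (A x)" "\<And>v. l * (norm v)\<^sup>2 \<le> (A x *v v) \<bullet> v"
    using rayleigh_minimum[OF sym[OF x]] by blast
  moreover have "lambda_min (A x) \<le> l"
    unfolding lambda_min_def using finite_eigenvals[OF sym[OF x]] l(1) by (rule Min_le)
  ultimately have "\<mu>0 * (norm v)\<^sup>2 \<le> l * (norm v)\<^sup>2" by (intro mult_right_mono) auto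
  with l(2)[of v] show ?thesis by linarith
qed

lemma bounded_bilinear_matrix_vector_mult:
  "bounded_bilinear ((*v) :: real^'d^'d \<Rightarrow> real^'d \<Rightarrow> real^'d)"
proof
  have "norm (M *v v) \<le> norm M * norm v * real CARD('d)" for M :: "real^'d^'d" and v
  proof -
    have "norm (M *v v) \<le> (\<Sum>i\<in>UNIV. \<bar>(M *v v) $ i\<bar>)" by (rule norm_le_l1_cart)
    also have "\<dots> \<le> (\<Sum>i\<in>(UNIV :: 'd set). norm M * norm v)"
    proof (rule sum_mono)
      fix i
      have "\<bar>(M *v v) $ i\<bar> \<le> norm (M $ i) * norm v"
        unfolding matrix_vector_mul_component by (rule Cauchy_Schwarz_ineq2)
      also have "\<dots> \<le> norm M * norm v"
        by (intro mult_right_mono Finite_Cartesian_Product.norm_nth_le) simp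
      finally show "\<bar>(M *v v) $ i\<bar> \<le> norm M * norm v" .
    qed
    finally show ?thesis by (simp add: mult.commute)
  qed
  then show "\<exists>K. \<forall>(M :: real^'d^'d) v. norm (M *v v) \<le> norm M * norm v * K" by blast
qed (simp_all add: matrix_vector_mult_add_rdistrib matrix_vector_right_distrib
    matrix_vector_mult_scaleR scaleR_matrix_vector_assoc)

locale elliptic_form = bounded_open_set \<Omega> for \<Omega> :: "(real^'d) set" +
  fixes A :: "real^'d \<Rightarrow> real^'d^'d" and \<mu>0 \<mu>1 :: real
  assumes elliptic: "elliptic_coefficient \<Omega> A \<mu>0 \<mu>1"
begin

lemma \<mu>0_pos: "0 < \<mu>0"
  using elliptic by (simp add: elliptic_coefficient_def)

lemma A_commute: "x \<in> \<Omega> \<Longrightarrow> (A x *v v) \<bullet> w = (A x *v w) \<bullet> v"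
  using elliptic by (intro symmetric_dot_commute) (simp add: elliptic_coefficient_def)

lemma A_nonneg: "x \<in> \<Omega> \<Longrightarrow> 0 \<le> (A x *v v) \<bullet> v"
  using elliptic_coefficient_lower_bound[OF elliptic, of x v] \<mu>0_pos
  by (meson mult_nonneg_nonneg less_imp_le order_trans zero_le_power2)

text \<open>A Lipschitz coefficient on a bounded set is bounded, which gives the norm estimate, and
  continuous, which gives measurability of the product through the bilinear map.\<close>

lemma flux_L2:
  assumes "G \<in> L2 \<Omega>"
  shows "(\<lambda>x. A x *v G x) \<in> L2 \<Omega>"
proof -
  obtain L where L: "L-lipschitz_on \<Omega> A" using elliptic by (auto simp: elliptic_coefficient_def)
  have "bounded (A ` \<Omega>)"
    by (intro bounded_uniformly_continuous_image lipschitz_on_uniformly_continuous[OF L] bounded_\<Omega>)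
  then obtain K where K: "\<And>x. x \<in> \<Omega> \<Longrightarrow> norm (A x) \<le> K"
    by (auto simp: bounded_iff)
  obtain c where c: "c > 0" "\<And>M v. norm ((M :: real^'d^'d) *v v) \<le> norm M * norm v * c"
    using bounded_bilinear.pos_bounded[OF bounded_bilinear_matrix_vector_mult] by blast
  have A: "A \<in> borel_measurable (lebesgue_on \<Omega>)"
    using lipschitz_on_continuous_on[OF L] \<Omega>_sets(1) by (rule continuous_imp_measurable_on_sets_lebesgue)
  show ?thesis
  proof (rule L2_bound[OF assms])
    show "(\<lambda>x. A x *v G x) \<in> borel_measurable (lebesgue_on \<Omega>)"
      by (intro borel_measurable_continuous_Pair[OF A L2D(1)[OF assms]]
          bounded_bilinear.continuous_on[OF bounded_bilinear_matrix_vector_mult] continuous_intros)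
    fix x assume "x \<in> \<Omega>"
    then have "norm (A x) * (norm (G x) * c) \<le> K * (norm (G x) * c)"
      using c(1) K by (intro mult_right_mono) auto
    with c(2)[of "A x" "G x"] show "norm (A x *v G x) \<le> (K * c) * norm (G x)"
      by (simp add: mult_ac)
  qed
qed

lemma form_integrable:
  assumes "G \<in> L2 \<Omega>" "H \<in> L2 \<Omega>"
  shows "integrable (lebesgue_on \<Omega>) (\<lambda>x. (A x *v G x) \<bullet> H x)"
  by (rule L2_inner_integrable[OF flux_L2 assms(2)]) (rule assms)

lemmas afrm_integrable = form_integrable[OF H1_in_L2(2) H1_in_L2(2)]

lemma afrm_commute: "afrm \<Omega> A v w = afrm \<Omega> A w v"
  unfolding afrm_def by (rule Bochner_Integration.integral_cong) (auto simp: space_restrict_space A_commute)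

lemma afrm_nonneg: "0 \<le> afrm \<Omega> A v v"
  unfolding afrm_def by (rule Bochner_Integration.integral_nonneg) (simp add: space_restrict_space A_nonneg)

lemma energy_norm_sq: "(energy_norm \<Omega> A v)\<^sup>2 = afrm \<Omega> A v v"
  by (simp add: energy_norm_def afrm_nonneg)

lemma afrm_diff_left:
  assumes "u \<in> H1 \<Omega>" "v \<in> H1 \<Omega>" "w \<in> H1 \<Omega>"
  shows "afrm \<Omega> A (\<lambda>x. u x - v x) w = afrm \<Omega> A u w - afrm \<Omega> A v w"
proof -
  have "afrm \<Omega> A (\<lambda>x. u x - v x) w
      = (LINT x|lebesgue_on \<Omega>. (A x *v wgrad \<Omega> u x) \<bullet> wgrad \<Omega> w x - (A x *v wgrad \<Omega> v x) \<bullet> wgrad \<Omega> w x)"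
    unfolding afrm_def
  proof (rule integral_cong_AE)
    show "AE x in lebesgue_on \<Omega>. (A x *v wgrad \<Omega> (\<lambda>x. u x - v x) x) \<bullet> wgrad \<Omega> w x
        = (A x *v wgrad \<Omega> u x) \<bullet> wgrad \<Omega> w x - (A x *v wgrad \<Omega> v x) \<bullet> wgrad \<Omega> w x"
      using wgrad_diff[OF assms(1,2)]
      by eventually_elim (simp add: matrix_vector_mult_diff_distrib inner_diff_left)
  qed (use afrm_integrable[OF H1_diff[OF assms(1,2)] assms(3)] afrm_integrable[OF assms(1,3)]
      afrm_integrable[OF assms(2,3)] in auto)
  then show ?thesis
    using afrm_integrable[OF assms(1,3)] afrm_integrable[OF assms(2,3)] by (simp add: afrm_def)
qed

text \<open>Pointwise, the form is nonnegative at the sum and at the difference of the two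
  gradients; expanding both gives the arithmetic-mean bound directly, without a Cauchy-Schwarz
  inequality.\<close>

lemma afrm_bound:
  assumes "v \<in> H1 \<Omega>" "w \<in> H1 \<Omega>"
  shows "\<bar>afrm \<Omega> A v w\<bar> \<le> (afrm \<Omega> A v v + afrm \<Omega> A w w) / 2"
proof -
  let ?f = "\<lambda>v w x. (A x *v wgrad \<Omega> v x) \<bullet> wgrad \<Omega> w x"
  have pointwise: "\<bar>?f v w x\<bar> \<le> (?f v v x + ?f w w x) / 2" if "x \<in> \<Omega>" for x
    using A_nonneg[OF that, of "wgrad \<Omega> v x - wgrad \<Omega> w x"] A_nonneg[OF that, of "wgrad \<Omega> v x + wgrad \<Omega> w x"]
      A_commute[OF that, of "wgrad \<Omega> v x" "wgrad \<Omega> w x"]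
    by (simp add: matrix_vector_right_distrib matrix_vector_mult_diff_distrib inner_simps)
  have "\<bar>afrm \<Omega> A v w\<bar> \<le> (LINT x|lebesgue_on \<Omega>. (?f v v x + ?f w w x) / 2)"
    unfolding afrm_def real_norm_def[symmetric]
    by (rule Bochner_Integration.integral_norm_bound_integral)
      (use pointwise assms in \<open>auto simp: space_restrict_space intro!: afrm_integrable\<close>)
  also have "\<dots> = (afrm \<Omega> A v v + afrm \<Omega> A w w) / 2"
    using afrm_integrable[OF assms(1,1)] afrm_integrable[OF assms(2,2)] by (simp add: afrm_def)
  finally show ?thesis .
qed

lemma afrm_coercive:
  assumes "v \<in> H1 \<Omega>"
  shows "\<mu>0 * (L2norm \<Omega> (wgrad \<Omega> v))\<^sup>2 \<le> afrm \<Omega> A v v"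
proof -
  have "\<mu>0 * (L2norm \<Omega> (wgrad \<Omega> v))\<^sup>2 = (LINT x|lebesgue_on \<Omega>. \<mu>0 * (norm (wgrad \<Omega> v x))\<^sup>2)"
    by (simp add: L2norm_sq)
  also have "\<dots> \<le> afrm \<Omega> A v v"
    unfolding afrm_def
    using L2D(2)[OF H1_in_L2(2)[OF assms]] afrm_integrable[OF assms assms]
      elliptic_coefficient_lower_bound[OF elliptic]
    by (intro integral_mono) (auto simp: space_restrict_space)
  finally show ?thesis .
qed

lemma L2_le_energy:
  obtains c where "0 < c" "\<And>v. v \<in> H10 \<Omega> \<Longrightarrow> (L2norm \<Omega> v)\<^sup>2 \<le> c * (energy_norm \<Omega> A v)\<^sup>2"
proof -
  obtain c where c: "0 < c" "\<And>v. v \<in> H10 \<Omega> \<Longrightarrow> (L2norm \<Omega> v)\<^sup>2 \<le> c * (L2norm \<Omega> (wgrad \<Omega> v))\<^sup>2"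
    using poincare by blast
  have "(L2norm \<Omega> v)\<^sup>2 \<le> c / \<mu>0 * (energy_norm \<Omega> A v)\<^sup>2" if v: "v \<in> H10 \<Omega>" for v
  proof -
    have "(L2norm \<Omega> (wgrad \<Omega> v))\<^sup>2 \<le> (energy_norm \<Omega> A v)\<^sup>2 / \<mu>0"
      using afrm_coercive[OF H10_in_H1[OF v]] \<mu>0_pos by (simp add: energy_norm_sq field_simps)
    from mult_left_mono[OF this, of c] c(1) c(2)[OF v] show ?thesis by simp
  qed
  with c(1) \<mu>0_pos show thesis by (intro that[of "c / \<mu>0"]) auto
qed

end

section \<open>The error in the goal function\<close>

lemma facet_integral_nonneg: "(\<And>x. 0 \<le> \<phi> x) \<Longrightarrow> 0 \<le> facet_integral \<nu> F \<phi>"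
  by (simp add: facet_integral_def)

text \<open>This permits dropping the estimators from the quasi-error. A nonexistent integral has
  the value 0, so no integrability is involved.\<close>

lemma estimator_sq_nonneg: "0 \<le> estimator_sq A r c T v t"
  unfolding estimator_sq_def jump_sq_def mesh_size_def
  by (intro add_nonneg_nonneg mult_nonneg_nonneg sum_nonneg facet_integral_nonneg) simp_all

lemma eta_sq_nonneg: "0 \<le> eta_sq A f b T v S"
  unfolding eta_sq_def by (intro sum_nonneg estimator_sq_nonneg)

lemma zeta_sq_nonneg: "0 \<le> zeta_sq A g b w T v S"
  unfolding zeta_sq_def by (intro sum_nonneg estimator_sq_nonneg)

text \<open>The factor t - s belongs to the estimate: on a one-point interval the Lipschitz
  condition does not control the derivative, but then t = s.\<close>

lemma abs_deriv_mult_diff_le: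
  fixes \<beta> :: "real \<Rightarrow> real"
  assumes "\<beta> field_differentiable (at t)" and lip: "B-lipschitz_on {m..p} \<beta>"
    and t: "t \<in> {m..p}" and s: "s \<in> {m..p}"
  shows "\<bar>deriv \<beta> t * (t - s)\<bar> \<le> B * \<bar>t - s\<bar>"
proof (cases "s = t")
  case False
  \<comment> \<open>Increments pointing towards s keep t + h n in the interval even if t is an
    endpoint, so the Lipschitz bound applies to every quotient.\<close>
  define h where "h n = (s - t) / real (Suc n)" for n
  have h0: "h n \<noteq> 0" for n using False by (simp add: h_def)
  have "h \<longlonglongrightarrow> 0"
    unfolding h_def using tendsto_mult_right[OF LIMSEQ_Suc[OF lim_1_over_n], of "s - t"] by simp
  then have "filterlim h (at 0) sequentially" using h0 by (simp add: filterlim_at)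
  moreover have "((\<lambda>h. (\<beta> (t + h) - \<beta> t) / h) \<longlongrightarrow> deriv \<beta> t) (at 0)"
    using assms(1) by (simp add: DERIV_def flip: DERIV_deriv_iff_field_differentiable)
  ultimately have "(\<lambda>n. (\<beta> (t + h n) - \<beta> t) / h n) \<longlonglongrightarrow> deriv \<beta> t"
    by (rule filterlim_compose[rotated])
  then have "(\<lambda>n. \<bar>(\<beta> (t + h n) - \<beta> t) / h n\<bar>) \<longlonglongrightarrow> \<bar>deriv \<beta> t\<bar>"
    by (rule tendsto_rabs)
  moreover have "\<bar>(\<beta> (t + h n) - \<beta> t) / h n\<bar> \<le> B" for n
  proof -
    have "(1 - 1 / real (Suc n)) *\<^sub>R t + (1 / real (Suc n)) *\<^sub>R s \<in> {m..p}"
      by (rule convexD_alt[OF _ t s]) auto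
    moreover have "(1 - 1 / real (Suc n)) *\<^sub>R t + (1 / real (Suc n)) *\<^sub>R s = t + h n"
      by (simp add: h_def divide_inverse algebra_simps del: of_nat_Suc)
    ultimately have "\<bar>\<beta> (t + h n) - \<beta> t\<bar> \<le> B * \<bar>h n\<bar>"
      using lipschitz_onD[OF lip _ t, of "t + h n"] by (simp add: dist_real_def)
    then show ?thesis using h0[of n] by (simp add: abs_divide pos_divide_le_eq)
  qed
  ultimately have "\<bar>deriv \<beta> t\<bar> \<le> B" by (intro LIMSEQ_le_const2) auto
  then show ?thesis by (simp add: abs_mult mult_right_mono)
qed simp

text \<open>By the mean value theorem the remainder is the derivative's difference between t and an
  intermediate point, times t - s. An integral remainder would give \<Theta>/2.\<close>

lemma abs_deriv_linearization_le:
  fixes \<beta> :: "real \<Rightarrow> real"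
  assumes diff: "\<And>r. \<beta> field_differentiable (at r)" and lip: "\<Theta>-lipschitz_on {m..p} (deriv \<beta>)"
    and t: "t \<in> {m..p}" and s: "s \<in> {m..p}"
  shows "\<bar>deriv \<beta> t * (t - s) - (\<beta> t - \<beta> s)\<bar> \<le> \<Theta> * (t - s)\<^sup>2"
proof -
  have D: "(\<beta> has_field_derivative deriv \<beta> r) (at r)" for r
    using diff by (simp add: DERIV_deriv_iff_field_differentiable)
  obtain \<xi> where \<xi>: "\<beta> t - \<beta> s = deriv \<beta> \<xi> * (t - s)" "min s t \<le> \<xi>" "\<xi> \<le> max s t"
  proof (cases s t rule: linorder_cases)
    case less
    then obtain z where "s < z" "z < t" "\<beta> t - \<beta> s = (t - s) * deriv \<beta> z" using MVT2 D by blast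
    then show ?thesis by (intro that[of z]) (auto simp: mult.commute)
  next
    case greater
    then obtain z where "t < z" "z < s" "\<beta> s - \<beta> t = (s - t) * deriv \<beta> z" using MVT2 D by blast
    then show ?thesis by (intro that[of z]) (auto simp: algebra_simps)
  qed (auto intro: that[of s])
  have "\<xi> \<in> {m..p}" using \<xi>(2,3) t s by auto
  then have "\<bar>deriv \<beta> t - deriv \<beta> \<xi>\<bar> \<le> \<Theta> * \<bar>t - \<xi>\<bar>"
    using lipschitz_onD[OF lip t] by (simp add: dist_real_def)
  also have "\<dots> \<le> \<Theta> * \<bar>t - s\<bar>"
    using \<xi>(2,3) lipschitz_on_nonneg[OF lip] by (intro mult_left_mono) auto
  finally have "\<bar>deriv \<beta> t - deriv \<beta> \<xi>\<bar> * \<bar>t - s\<bar> \<le> \<Theta> * \<bar>t - s\<bar> * \<bar>t - s\<bar>"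
    by (intro mult_right_mono) auto
  moreover have "deriv \<beta> t * (t - s) - (\<beta> t - \<beta> s) = (deriv \<beta> t - deriv \<beta> \<xi>) * (t - s)"
    using \<xi>(1) by (simp add: algebra_simps)
  ultimately show ?thesis by (simp add: abs_mult power2_eq_square mult.assoc)
qed

text \<open>Inserting \<beta>'(t) (t - s) z' separates a product of primal and dual errors from a
  linearisation error times the bounded z'. Absolute values of \<open>B\<close> and \<Theta> keep
  the constants nonnegative by form.\<close>

lemma reaction_remainder_bound:
  fixes \<beta> :: "real \<Rightarrow> real"
  assumes diff: "\<And>r. \<beta> field_differentiable (at r)"
    and lip: "B-lipschitz_on {m..p} \<beta>" "\<Theta>-lipschitz_on {m..p} (deriv \<beta>)"
    and ts: "t \<in> {m..p}" "s \<in> {m..p}" and z: "\<bar>z'\<bar> \<le> M"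
  shows "\<bar>deriv \<beta> t * z * (t - s) - (\<beta> t - \<beta> s) * z'\<bar>
    \<le> (\<bar>B\<bar> + \<bar>\<Theta>\<bar> * M) * (t - s)\<^sup>2 + \<bar>B\<bar> * (z - z')\<^sup>2"
proof -
  have "\<bar>deriv \<beta> t * (t - s)\<bar> * \<bar>z - z'\<bar> \<le> (\<bar>B\<bar> * \<bar>t - s\<bar>) * \<bar>z - z'\<bar>"
    using abs_deriv_mult_diff_le[OF diff lip(1) ts] abs_of_nonneg[OF lipschitz_on_nonneg[OF lip(1)]]
    by (intro mult_right_mono) auto
  also have "\<dots> \<le> \<bar>B\<bar> * ((t - s)\<^sup>2 + (z - z')\<^sup>2)"
  proof -
    have "\<bar>t - s\<bar> * \<bar>z - z'\<bar> \<le> \<bar>t - s\<bar>\<^sup>2 + \<bar>z - z'\<bar>\<^sup>2"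
      using sum_squares_bound[of "\<bar>t - s\<bar>" "\<bar>z - z'\<bar>"] mult_nonneg_nonneg[of "\<bar>t - s\<bar>" "\<bar>z - z'\<bar>"] by linarith
    then show ?thesis by (simp add: mult.assoc mult_left_mono)
  qed
  finally have 1: "\<bar>deriv \<beta> t * (t - s) * (z - z')\<bar> \<le> \<bar>B\<bar> * ((t - s)\<^sup>2 + (z - z')\<^sup>2)"
    by (simp add: abs_mult)
  have "\<bar>deriv \<beta> t * (t - s) - (\<beta> t - \<beta> s)\<bar> * \<bar>z'\<bar> \<le> (\<bar>\<Theta>\<bar> * (t - s)\<^sup>2) * M"
    using abs_deriv_linearization_le[OF diff lip(2) ts] abs_of_nonneg[OF lipschitz_on_nonneg[OF lip(2)]] z
    by (intro mult_mono) auto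
  then have 2: "\<bar>(deriv \<beta> t * (t - s) - (\<beta> t - \<beta> s)) * z'\<bar> \<le> \<bar>\<Theta>\<bar> * M * (t - s)\<^sup>2"
    by (simp add: abs_mult mult_ac)
  have "deriv \<beta> t * z * (t - s) - (\<beta> t - \<beta> s) * z'
      = deriv \<beta> t * (t - s) * (z - z') + (deriv \<beta> t * (t - s) - (\<beta> t - \<beta> s)) * z'"
    by (simp add: algebra_simps)
  then have "\<bar>deriv \<beta> t * z * (t - s) - (\<beta> t - \<beta> s) * z'\<bar>
      \<le> \<bar>B\<bar> * ((t - s)\<^sup>2 + (z - z')\<^sup>2) + \<bar>\<Theta>\<bar> * M * (t - s)\<^sup>2"
    using 1 2 by linarith
  then show ?thesis unfolding distrib_left distrib_right by linarith
qed

context elliptic_form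
begin

text \<open>Galerkin orthogonality of the primal error against the discrete dual solution turns the goal
  error into a product of primal and dual errors and a remainder of second order.\<close>

lemma goal_error_identity:
  assumes V: "V \<subseteq> H10 \<Omega>" and g: "g \<in> L2 \<Omega>"
    and u: "semilinear_solution \<Omega> A b f (H10 \<Omega>) u" and u': "semilinear_solution \<Omega> A b f V u'"
    and z: "linear_solution \<Omega> A c g (H10 \<Omega>) z" and z': "z' \<in> V"
  shows "integrable (lebesgue_on \<Omega>) (\<lambda>x. c x * z x * (u x - u' x) - (b x (u x) - b x (u' x)) * z' x)"
    and "pairing \<Omega> g u - pairing \<Omega> g u' = afrm \<Omega> A (\<lambda>x. z x - z' x) (\<lambda>x. u x - u' x)
      + (LINT x|lebesgue_on \<Omega>. c x * z x * (u x - u' x) - (b x (u x) - b x (u' x)) * z' x)"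
proof -
  let ?e = "\<lambda>x. u x - u' x"
  have mem: "u \<in> H10 \<Omega>" "u' \<in> H10 \<Omega>" "z \<in> H10 \<Omega>" "z' \<in> H10 \<Omega>"
    using V u u' z z' by (auto simp: semilinear_solution_def linear_solution_def)
  then have e: "?e \<in> H10 \<Omega>" by (intro H10_diff)
  note H1 = mem[THEN H10_in_H1] and eH1 = H10_in_H1[OF e]
  have bu: "(\<lambda>x. b x (u x)) \<in> L2 \<Omega>" "(\<lambda>x. b x (u' x)) \<in> L2 \<Omega>" and cz: "(\<lambda>x. c x * z x) \<in> L2 \<Omega>"
    using u u' z by (simp_all add: semilinear_solution_def linear_solution_def)
  \<comment> \<open>The solution predicates place exactly these reaction terms in \<open>L2\<close>.
    The remainder is therefore kept as one integrand here and separated into two parts only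
    pointwise.\<close>
  note int = L2_mult_integrable[OF cz H1_in_L2(1)[OF eH1]]
    L2_mult_integrable[OF L2_diff[OF bu] H1_in_L2(1)[OF H1(4)]]
  show "integrable (lebesgue_on \<Omega>) (\<lambda>x. c x * z x * ?e x - (b x (u x) - b x (u' x)) * z' x)"
    by (intro Bochner_Integration.integrable_diff int)
  have "pairing \<Omega> g ?e = pairing \<Omega> g u - pairing \<Omega> g u'"
    unfolding pairing_def using L2_mult_integrable[OF g H1_in_L2(1)] H1 by (simp add: right_diff_distrib)
  moreover have "afrm \<Omega> A z ?e + pairing \<Omega> (\<lambda>x. c x * z x) ?e = pairing \<Omega> g ?e"
    using z e by (simp add: linear_solution_def)
  moreover have "afrm \<Omega> A u z' + pairing \<Omega> (\<lambda>x. b x (u x)) z' = pairing \<Omega> f z'"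
    "afrm \<Omega> A u' z' + pairing \<Omega> (\<lambda>x. b x (u' x)) z' = pairing \<Omega> f z'"
    using u u' z' mem(4) by (simp_all add: semilinear_solution_def)
  \<comment> \<open>Symmetry of the form moves z' into the test slot, where the two primal equations
    can be subtracted.\<close>
  moreover have "afrm \<Omega> A (\<lambda>x. z x - z' x) ?e = afrm \<Omega> A z ?e - (afrm \<Omega> A u z' - afrm \<Omega> A u' z')"
    unfolding afrm_diff_left[OF H1(3,4) eH1] afrm_diff_left[OF H1(1,2,4), symmetric]
    by (simp add: afrm_commute)
  moreover have "(LINT x|lebesgue_on \<Omega>. (b x (u x) - b x (u' x)) * z' x)
      = pairing \<Omega> (\<lambda>x. b x (u x)) z' - pairing \<Omega> (\<lambda>x. b x (u' x)) z'"
    unfolding pairing_def left_diff_distrib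
    by (intro Bochner_Integration.integral_diff L2_mult_integrable bu H1_in_L2(1) H1)
  moreover have "(LINT x|lebesgue_on \<Omega>. c x * z x * ?e x - (b x (u x) - b x (u' x)) * z' x)
      = pairing \<Omega> (\<lambda>x. c x * z x) ?e - (LINT x|lebesgue_on \<Omega>. (b x (u x) - b x (u' x)) * z' x)"
    unfolding pairing_def by (rule Bochner_Integration.integral_diff[OF int])
  ultimately show "pairing \<Omega> g u - pairing \<Omega> g u' = afrm \<Omega> A (\<lambda>x. z x - z' x) ?e
      + (LINT x|lebesgue_on \<Omega>. c x * z x * ?e x - (b x (u x) - b x (u' x)) * z' x)"
    by linarith
qed

end

text \<open>\<open>M\<close> is fixed before \<open>z\<close> is quantified: one bound then serves
  all discrete dual solutions.\<close>

lemma Linf_abs_bound: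
  assumes "zm \<in> Linf \<Omega>" "zp \<in> Linf \<Omega>"
  obtains M where "0 \<le> M"
    "\<And>z. AE x in lebesgue_on \<Omega>. zm x \<le> z x \<and> z x \<le> zp x \<Longrightarrow> AE x in lebesgue_on \<Omega>. \<bar>z x\<bar> \<le> M"
proof -
  obtain M1 M2 where M: "AE x in lebesgue_on \<Omega>. \<bar>zm x\<bar> \<le> M1" "AE x in lebesgue_on \<Omega>. \<bar>zp x\<bar> \<le> M2"
    using assms by (auto simp: Linf_def)
  show thesis
  proof (rule that[of "\<bar>M1\<bar> + \<bar>M2\<bar>"])
    fix z assume "AE x in lebesgue_on \<Omega>. zm x \<le> z x \<and> z x \<le> zp x"
    with M show "AE x in lebesgue_on \<Omega>. \<bar>z x\<bar> \<le> \<bar>M1\<bar> + \<bar>M2\<bar>"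
      by eventually_elim linarith
  qed simp
qed

theorem corollary5p10:
  fixes \<Omega> :: "(real^'d) set"
    and A :: "real^'d \<Rightarrow> real^'d^'d" and b :: "real^'d \<Rightarrow> real \<Rightarrow> real" and f g :: "real^'d \<Rightarrow> real"
    and \<mu>0 \<mu>1 \<sigma> \<theta> B \<Theta> s K\<^sub>R K\<^sub>R' \<gamma>\<^sub>p \<alpha> \<gamma> \<pi> \<alpha>\<^sub>D :: real and n :: nat
    and T :: "nat \<Rightarrow> 'd tagged set" and V :: "nat \<Rightarrow> (real^'d \<Rightarrow> real) set"
    and u zh um up zm zp :: "real^'d \<Rightarrow> real"
    and uk zhk zk :: "nat \<Rightarrow> real^'d \<Rightarrow> real"
    and Q :: "nat \<Rightarrow> real"
  assumes dim: "CARD('d) = 2 \<or> CARD('d) = 3"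
    and domain: "polyhedral_domain \<Omega>"
    and coeff_A: "elliptic_coefficient \<Omega> A \<mu>0 \<mu>1"
    and coeff_b: "smooth_monotone \<Omega> b"
    and data_f: "f \<in> L2 \<Omega>" and data_g: "g \<in> L2 \<Omega>"
    and mesh0: "conforming_mesh \<Omega> (T 0)" "shape_regular \<sigma> (T 0)"
    and spaces: "\<And>k. V k = fe_space \<Omega> n (T k)"
    and primal: "semilinear_solution \<Omega> A b f (H10 \<Omega>) u"
    and discrete_primal: "\<And>k. semilinear_solution \<Omega> A b f (V k) (uk k)"
    and limiting_dual: "linear_solution \<Omega> A (\<lambda>x. deriv (b x) (u x)) g (H10 \<Omega>) zh"
    and discrete_limiting_dual: "\<And>k. linear_solution \<Omega> A (\<lambda>x. deriv (b x) (u x)) g (V k) (zhk k)"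
    and approximate_dual: "\<And>k. linear_solution \<Omega> A (\<lambda>x. deriv (b x) (uk k x)) g (V k) (zk k)"
    and primal_bounds: "um \<in> Linf \<Omega>" "up \<in> Linf \<Omega>"
      "AE x in lebesgue_on \<Omega>. um x \<le> u x \<and> u x \<le> up x"
      "\<And>k. AE x in lebesgue_on \<Omega>. um x \<le> uk k x \<and> uk k x \<le> up x"
    and b_lipschitz: "AE x in lebesgue_on \<Omega>. B-lipschitz_on {um x..up x} (b x)"
      "AE x in lebesgue_on \<Omega>. \<Theta>-lipschitz_on {um x..up x} (deriv (b x))"
    and dual_bounds: "zm \<in> Linf \<Omega>" "zp \<in> Linf \<Omega>"
      "AE x in lebesgue_on \<Omega>. zm x \<le> zh x \<and> zh x \<le> zp x"
      "\<And>k. AE x in lebesgue_on \<Omega>. zm x \<le> zhk k x \<and> zhk k x \<le> zp x"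
      "\<And>k. AE x in lebesgue_on \<Omega>. zm x \<le> zk k x \<and> zk k x \<le> zp x"
    and regularity_exponent: "0 < s" "s \<le> 1"
    and primal_regularity: "\<And>j w.
      linear_solution \<Omega> A (\<lambda>x. integral {0..1} (\<lambda>\<xi>. deriv (b x) (\<xi> * u x + (1 - \<xi>) * uk j x)))
        (\<lambda>x. u x - uk j x) (H10 \<Omega>) w \<Longrightarrow>
      w \<in> H1s \<Omega> s \<and> H1s_seminorm \<Omega> s w \<le> K\<^sub>R * L2norm \<Omega> (\<lambda>x. u x - uk j x)"
    and dual_regularity: "\<And>j y.
      linear_solution \<Omega> A (\<lambda>x. deriv (b x) (u x)) (\<lambda>x. zh x - zhk j x) (H10 \<Omega>) y \<Longrightarrow>
      y \<in> H1s \<Omega> s \<and> H1s_seminorm \<Omega> s y \<le> K\<^sub>R' * L2norm \<Omega> (\<lambda>x. zh x - zhk j x)"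
    and marking_parameter: "0 < \<theta>" "\<theta> \<le> 1"
    and goafem: "\<And>k. goafem_step \<Omega> A b f g \<theta> (uk k) (zk k) (T k) (T (Suc k))"
    and primal_contraction: "0 < \<gamma>\<^sub>p" "0 < \<alpha>" "\<alpha> < 1"
      "\<And>j. (energy_norm \<Omega> A (\<lambda>x. u x - uk (Suc j) x))\<^sup>2
              + \<gamma>\<^sub>p * eta_sq A f b (T (Suc j)) (uk (Suc j)) (T (Suc j))
            \<le> \<alpha>\<^sup>2 * ((energy_norm \<Omega> A (\<lambda>x. u x - uk j x))\<^sup>2
              + \<gamma>\<^sub>p * eta_sq A f b (T j) (uk j) (T j))"
    and quasi_error: "\<And>j. Q j =
      (energy_norm \<Omega> A (\<lambda>x. zh x - zhk j x))\<^sup>2 + \<gamma> * zeta_sq A g b u (T j) (zhk j) (T j)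
      + \<pi> * (energy_norm \<Omega> A (\<lambda>x. u x - uk j x))\<^sup>2 + \<pi> * \<gamma>\<^sub>p * eta_sq A f b (T j) (uk j) (T j)"
    and contraction: "0 < \<gamma>" "0 < \<pi>" "0 < \<alpha>\<^sub>D" "\<alpha>\<^sub>D < 1"
      "\<And>j. Q (Suc j) \<le> \<alpha>\<^sub>D\<^sup>2 * Q j"
  shows "\<exists>C>0. \<forall>j. \<bar>pairing \<Omega> g u - pairing \<Omega> g (uk j)\<bar> \<le> C * Q j \<and>
                  C * Q j \<le> \<alpha>\<^sub>D ^ (2 * j) * C * Q 0"
proof -
  have "open \<Omega>" "bounded \<Omega>" using polyhedral_domain_open_bounded[OF domain] by blast+
  then interpret elliptic_form \<Omega> A \<mu>0 \<mu>1
    using coeff_A by unfold_locales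
  let ?E = "\<lambda>j. (energy_norm \<Omega> A (\<lambda>x. u x - uk j x))\<^sup>2"
  let ?W = "\<lambda>j. (energy_norm \<Omega> A (\<lambda>x. zh x - zhk j x))\<^sup>2"
  obtain c where c: "0 < c" "\<And>v. v \<in> H10 \<Omega> \<Longrightarrow> (L2norm \<Omega> v)\<^sup>2 \<le> c * (energy_norm \<Omega> A v)\<^sup>2"
    using L2_le_energy by blast
  obtain M where M: "0 \<le> M" "\<And>z. AE x in lebesgue_on \<Omega>. zm x \<le> z x \<and> z x \<le> zp x \<Longrightarrow>
      AE x in lebesgue_on \<Omega>. \<bar>z x\<bar> \<le> M"
    using Linf_abs_bound[OF dual_bounds(1,2)] by blast
  \<comment> \<open>The coefficient of the squared primal error; it also majorises the coefficient
    |B| of the squared dual error, so one constant covers both.\<close>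
  define K where "K = \<bar>B\<bar> + \<bar>\<Theta>\<bar> * M"
  have K: "\<bar>B\<bar> \<le> K" "0 \<le> K" using M(1) by (auto simp: K_def)
  have goal: "\<bar>pairing \<Omega> g u - pairing \<Omega> g (uk j)\<bar> \<le> (1 / 2 + K * c) * (?E j + ?W j)" for j
  proof -
    let ?e = "\<lambda>x. u x - uk j x" and ?w = "\<lambda>x. zh x - zhk j x"
    let ?r = "\<lambda>x. deriv (b x) (u x) * zh x * ?e x - (b x (u x) - b x (uk j x)) * zhk j x"
    have V: "V j \<subseteq> H10 \<Omega>" by (auto simp: spaces fe_space_def)
    have H10: "?e \<in> H10 \<Omega>" "?w \<in> H10 \<Omega>"
      using V primal discrete_primal[of j] limiting_dual discrete_limiting_dual[of j]
      by (auto simp: semilinear_solution_def linear_solution_def intro!: H10_diff)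
    have "zhk j \<in> V j" using discrete_limiting_dual[of j] by (simp add: linear_solution_def)
    note id = goal_error_identity[OF V data_g primal discrete_primal[of j] limiting_dual this]
    have L2: "?e \<in> L2 \<Omega>" "?w \<in> L2 \<Omega>" using H10 by (auto intro: H1_in_L2 H10_in_H1)
    have "\<bar>LINT x|lebesgue_on \<Omega>. ?r x\<bar> \<le> (LINT x|lebesgue_on \<Omega>. \<bar>?r x\<bar>)"
      by (rule integral_abs_bound)
    also have "\<dots> \<le> (LINT x|lebesgue_on \<Omega>. K * (?e x)\<^sup>2 + \<bar>B\<bar> * (?w x)\<^sup>2)"
    proof (rule integral_mono_AE)
      show "integrable (lebesgue_on \<Omega>) (\<lambda>x. \<bar>?r x\<bar>)" by (intro integrable_abs id)
      show "integrable (lebesgue_on \<Omega>) (\<lambda>x. K * (?e x)\<^sup>2 + \<bar>B\<bar> * (?w x)\<^sup>2)"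
        using L2D(2)[OF L2(1)] L2D(2)[OF L2(2)] by simp
      \<comment> \<open>The zeroth iterate in \<open>smooth_monotone\<close> is b(x, .)
        itself.\<close>
      have diff: "b x field_differentiable (at t)" if "x \<in> \<Omega>" for x t
        using coeff_b that unfolding smooth_monotone_def by (metis funpow_0)
      have "AE x in lebesgue_on \<Omega>. x \<in> \<Omega>" by (rule AE_I2) (simp add: space_restrict_space)
      then show "AE x in lebesgue_on \<Omega>. \<bar>?r x\<bar> \<le> K * (?e x)\<^sup>2 + \<bar>B\<bar> * (?w x)\<^sup>2"
        using primal_bounds(3) primal_bounds(4)[of j] b_lipschitz M(2)[OF dual_bounds(4)[of j]]
        unfolding K_def by eventually_elim (rule reaction_remainder_bound, auto intro: diff)
    qed
    also have "\<dots> = K * (L2norm \<Omega> ?e)\<^sup>2 + \<bar>B\<bar> * (L2norm \<Omega> ?w)\<^sup>2"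
      using L2D(2)[OF L2(1)] L2D(2)[OF L2(2)] by (simp add: L2norm_sq)
    also have "\<dots> \<le> K * (c * ?E j) + K * (c * ?W j)"
      using c(2)[OF H10(1)] c(2)[OF H10(2)] K by (intro add_mono mult_mono) auto
    finally have "\<bar>LINT x|lebesgue_on \<Omega>. ?r x\<bar> \<le> K * c * (?E j + ?W j)"
      by (simp add: distrib_left mult.assoc)
    moreover have "\<bar>afrm \<Omega> A ?w ?e\<bar> \<le> 1 / 2 * (?E j + ?W j)"
      using afrm_bound[OF H10(2,1)[THEN H10_in_H1]] by (simp add: energy_norm_sq)
    ultimately show ?thesis unfolding id(2) distrib_right by linarith
  qed
  define C0 where "C0 = 1 / 2 + K * c"
  \<comment> \<open>Since (1 + 1/\<pi>)(W + \<pi> E) = W + E + \<pi> E + W/\<pi>, this factor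
    recovers the unweighted sum of squared errors for every \<pi> > 0.\<close>
  define C where "C = C0 * (1 + 1 / \<pi>)"
  have C0: "0 < C0" using K c by (simp add: C0_def add_pos_nonneg)
  then have C: "0 < C" using contraction(2) by (simp add: C_def add_pos_pos)
  have "\<bar>pairing \<Omega> g u - pairing \<Omega> g (uk j)\<bar> \<le> C * Q j" for j
  proof -
    have Q: "?W j + \<pi> * ?E j \<le> Q j"
      unfolding quasi_error using contraction(1,2) primal_contraction(1)
      by (simp add: add_nonneg_nonneg mult_nonneg_nonneg eta_sq_nonneg zeta_sq_nonneg less_imp_le)
    have "?E j + ?W j \<le> (1 + 1 / \<pi>) * (?W j + \<pi> * ?E j)"
      using contraction(2) by (simp add: field_simps)
    also have "\<dots> \<le> (1 + 1 / \<pi>) * Q j"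
      using contraction(2) by (intro mult_left_mono Q) (simp add: add_nonneg_nonneg)
    finally have "C0 * (?E j + ?W j) \<le> C0 * ((1 + 1 / \<pi>) * Q j)"
      using C0 by (intro mult_left_mono) auto
    with goal[of j] show ?thesis by (simp add: C0_def C_def mult.assoc)
  qed
  \<comment> \<open>Each contraction step contributes one square of \<open>\<alpha>\<^sub>D\<close>,
    hence the exponent 2 j.\<close>
  moreover have decay: "Q j \<le> \<alpha>\<^sub>D ^ (2 * j) * Q 0" for j
  proof (induction j)
    case (Suc j)
    have "Q (Suc j) \<le> \<alpha>\<^sub>D\<^sup>2 * Q j" by (rule contraction)
    also have "\<dots> \<le> \<alpha>\<^sub>D\<^sup>2 * (\<alpha>\<^sub>D ^ (2 * j) * Q 0)" using Suc by (intro mult_left_mono) auto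
    finally show ?case by (simp add: power2_eq_square mult.assoc)
  qed simp
  have "C * Q j \<le> \<alpha>\<^sub>D ^ (2 * j) * C * Q 0" for j
    using mult_left_mono[OF decay[of j], of C] C by (simp add: mult_ac)
  ultimately show ?thesis using C by blast
qed

end
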